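(* Let $u\in\mathbb{Z}$ and $C(z),D(z)\in\mathbb{Z}[z]$ with $D(0)=1$, and let $f(z)\in\mathbb{Z}[[z]]$ be the power series $$f(z)=\prod_{n\ge 0}\Bigl(1+uz^{2^n}+2z^{2^{n+1}}\frac{C(z^{2^n})}{D(z^{2^n})}\Bigr).$$ Let $b\ge 2$ be an integer such that $D(1/b^{2^m})\,f(1/b^{2^m})\neq 0$ for all integers $m\ge 0$. If the reduction of $f(z)$ modulo $4$ is not a rational function, then $f(1/b)$ is transcendental and its irrationality exponent is equal to $2$.
   Context: The reduction of $f$ modulo $4$ is the series in $(\mathbb{Z}/4\mathbb{Z})[[z]]$ obtained by reducing each coefficient modulo 4; it is a rational function if there exist polynomials $P,Q\in(\mathbb{Z}/4\mathbb{Z})[z]$ with $Q(0)=1$ such that $Q(z)f(z)\equiv P(z)$ modulo 4. The irrationality exponent $\mu(\xi)$ of an irrational real number $\xi$ is the supremum of the real numbers $\mu$ such that $|\xi-p/q|<q^{-\mu}$ has infinitely many solutions in rational numbers $p/q$. *)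

theory Defs
  imports "HOL-Analysis.Analysis" "HOL-Computational_Algebra.Computational_Algebra"
begin

(* The n-th factor 1 + u z^(2^n) + 2 z^(2^(n+1)) C(z^(2^n)) / D(z^(2^n)) as a formal
   power series (with real coefficients; D(0) = 1 makes the division meaningful). *)
definition mfactor_fps :: "int \<Rightarrow> int poly \<Rightarrow> int poly \<Rightarrow> nat \<Rightarrow> real fps" where
  "mfactor_fps u C D n =
     1 + of_int u * fps_X ^ (2 ^ n)
       + 2 * fps_X ^ (2 ^ (n + 1))
         * fps_of_poly (pcompose (map_poly of_int C) (monom 1 (2 ^ n)))
         * inverse (fps_of_poly (pcompose (map_poly of_int D) (monom 1 (2 ^ n))))"

(* The infinite product as a formal power series: factor n is 1 + O(z^(2^n)), so the
   k-th coefficient of the product is that of the finite product of factors 0..k. *)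
definition mprod_fps :: "int \<Rightarrow> int poly \<Rightarrow> int poly \<Rightarrow> real fps" where
  "mprod_fps u C D = Abs_fps (\<lambda>k. fps_nth (\<Prod>n<Suc k. mfactor_fps u C D n) k)"

definition mprod_val :: "int \<Rightarrow> int poly \<Rightarrow> int poly \<Rightarrow> real \<Rightarrow> real" where
  "mprod_val u C D x =
     prodinf (\<lambda>n. 1 + of_int u * x ^ (2 ^ n)
        + 2 * x ^ (2 ^ (n + 1)) * poly (map_poly of_int C) (x ^ (2 ^ n))
            / poly (map_poly of_int D) (x ^ (2 ^ n)))"

(* reduction mod 4 of an integer-coefficient series f is rational: there are P, Q
   (lifted to integer polynomials) with Q(0) = 1 and Q f == P (mod 4) coefficientwise *)
definition rational_mod4 :: "real fps \<Rightarrow> bool" where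
  "rational_mod4 f \<longleftrightarrow>
     (\<exists>P Q :: int poly. coeff Q 0 = 1 \<and>
        (\<forall>n. \<exists>k::int. fps_nth (fps_of_poly (map_poly of_int Q) * f) n
                        = of_int (coeff P n) + 4 * of_int k))"

definition irrationality_exponent :: "real \<Rightarrow> ereal" where
  "irrationality_exponent xi =
     (SUP mu \<in> {mu::real. infinite {r::rat.
         \<bar>xi - of_rat r\<bar> < real_of_int (snd (quotient_of r)) powr (- mu)}}. ereal mu)"

end

theory Submission
  imports Defs "HOL-Library.Z2"
begin

text \<open>
  Write \<open>A = N / D\<close> for the factor, so that \<open>f(z) = A(z) f(z\<^sup>2)\<close>, and let \<open>w = u mod 2\<close>. Modulo 2 the
  series \<open>(1 - w z) f(z)\<close> is 1, so it equals \<open>1 + 2 G\<close>, and the reduction \<open>g\<close> of \<open>G\<close> satisfies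
  \<open>g(z) - g(z\<^sup>2) = T / M\<close> with \<open>g(z\<^sup>2) = g\<^sup>2\<close>: it is quadratic over \<open>F\<^sub>2(z)\<close>, and irrational by hypothesis.
  Taking norms as in Liouville's theorem, \<open>q g - p\<close> vanishes at 0 to order at most \<open>2 n + d\<close> for polynomials
  of degree at most \<open>n\<close>, and this lifts to \<open>Q f - P\<close> for integer polynomials.

  Hence \<open>f\<close> has Pade approximants of every degree with controlled order of vanishing. Evaluating them at
  \<open>b ^ (-2 ^ m)\<close> and multiplying by the first \<open>m\<close> factors of the product gives rational approximations to
  \<open>f(1/b)\<close> dense enough to force irrationality exponent 2.

  An algebraic function \<open>f\<close> with \<open>f(z) = A(z) f(z\<^sup>2)\<close> is a root of a rational function, and comparing orders of
  zeros along iterated square roots shows that it is rational; so \<open>f\<close> is transcendental over \<open>Q(z)\<close>. Mahler's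
  method (an auxiliary polynomial in \<open>z\<close> and \<open>f\<close>, and Liouville's inequality) then gives the transcendence of
  \<open>f(1/b)\<close>.
\<close>

text \<open>Modulo 2 the series is rational whatever the data are, so modulo 4 is the first level at
  which the hypothesis says something; there Frobenius turns the functional equation into an
  algebraic one. What has to be extracted is uniformity: approximants of degree n exceed the generic
  order 2 n + 1 by an amount bounded independently of n. At Y = b ^ 2 ^ m heights are then at most Y
  ^ (a + O(1)) and errors lie between Y ^ (-a - O(1)) and Y ^ (-a), up to constants depending on a,
  with one O(1) for all a. Passing from m to m + 1 squares Y, so one degree alone would leave gaps;
  letting a run over N + 1, ..., 2 N fills them at a cost O(1 / N) in the exponent. The nonvanishing
  hypothesis keeps the factors carried along from being 0, so that no approximation degenerates.
  Irrationality exponent 2 does not imply transcendence, hence the second argument; there the series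
  must be transcendental, not just irrational, for the auxiliary function to be nonzero.\<close>

section \<open>Integer linear systems with more unknowns than equations\<close>

text \<open>Fraction-free Gaussian elimination: cross-multiplying with a pivot row removes one
  unknown and one equation without leaving the integers. No size bound is asked for, because a
  solution is always fixed before the evaluation point tends to 0.\<close>

lemma int_kernel_nontrivial:
  fixes c :: "'j \<Rightarrow> 'i \<Rightarrow> int"
  assumes "finite J" "finite I" "card J < card I"
  shows "\<exists>x. (\<exists>i\<in>I. x i \<noteq> 0) \<and> (\<forall>j\<in>J. (\<Sum>i\<in>I. c j i * x i) = 0)"
  using assms
proof (induction J arbitrary: I c rule: finite_induct)
  case empty
  then obtain i where "i \<in> I" by fastforce
  then show ?case by (intro exI[of _ "\<lambda>_. 1"]) auto
next
  case (insert j0 J)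
  show ?case
  proof (cases "\<forall>i\<in>I. c j0 i = 0")
    case True
    have "card J < card I" using insert.prems insert.hyps by simp
    then obtain x where x: "\<exists>i\<in>I. x i \<noteq> 0" "\<forall>j\<in>J. (\<Sum>i\<in>I. c j i * x i) = 0"
      using insert.IH[of I c] insert.prems by blast
    then show ?thesis using True by (intro exI[of _ x]) simp
  next
    case False
    then obtain i0 where i0: "i0 \<in> I" "c j0 i0 \<noteq> 0" by blast
    have "card J < card (I - {i0})"
      using insert.prems insert.hyps i0 by simp
    then obtain y where y: "\<exists>i\<in>I - {i0}. y i \<noteq> 0"
      "\<And>j. j \<in> J \<Longrightarrow> (\<Sum>i\<in>I - {i0}. (c j0 i0 * c j i - c j i0 * c j0 i) * y i) = 0"
      using insert.IH[of "I - {i0}" "\<lambda>j i. c j0 i0 * c j i - c j i0 * c j0 i"] insert.prems by auto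
    \<comment> \<open>Back substitution: \<open>y\<close> is scaled by the pivot so that the value
      at \<open>i0\<close> which solves row \<open>j0\<close> is an integer.\<close>
    define x where "x = (\<lambda>i. if i = i0 then - (\<Sum>i\<in>I - {i0}. c j0 i * y i) else c j0 i0 * y i)"
    have split: "(\<Sum>i\<in>I. c j i * x i) =
        (\<Sum>i\<in>I - {i0}. (c j0 i0 * c j i - c j i0 * c j0 i) * y i)" for j
    proof -
      have "(\<Sum>i\<in>I. c j i * x i) = c j i0 * x i0 + (\<Sum>i\<in>I - {i0}. c j i * x i)"
        using i0 insert.prems by (simp add: sum.remove)
      also have "(\<Sum>i\<in>I - {i0}. c j i * x i) = (\<Sum>i\<in>I - {i0}. c j0 i0 * c j i * y i)"
        by (intro sum.cong) (auto simp: x_def)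
      also have "c j i0 * x i0 = - (\<Sum>i\<in>I - {i0}. c j i0 * c j0 i * y i)"
        by (simp add: x_def sum_distrib_left mult.assoc)
      finally show ?thesis by (simp add: sum_subtractf left_diff_distrib)
    qed
    have "(\<Sum>i\<in>I. c j0 i * x i) = 0"
      unfolding split by simp
    moreover have "\<exists>i\<in>I. x i \<noteq> 0"
      using y(1) i0 by (auto simp: x_def)
    ultimately show ?thesis using split y(2) by auto
  qed
qed

section \<open>Coefficient maps, the substitution z -> z^2, and Frobenius\<close>

abbreviation of_int_poly :: "int poly \<Rightarrow> 'a::ring_1 poly" where
  "of_int_poly \<equiv> map_poly of_int"

text \<open>The target ring is left open because three are used: \<open>bit\<close> for reduction
  modulo 2, \<open>real\<close> for evaluation, \<open>complex\<close> for extracting roots.\<close>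

definition of_int_fps :: "int fps \<Rightarrow> 'a::ring_1 fps" where
  "of_int_fps f = Abs_fps (\<lambda>n. of_int (fps_nth f n))"

lemma of_int_fps_nth [simp]: "fps_nth (of_int_fps f) n = of_int (fps_nth f n)"
  by (simp add: of_int_fps_def)

lemma of_int_fps_0 [simp]: "of_int_fps 0 = 0"
  and of_int_fps_1 [simp]: "of_int_fps 1 = 1"
  and of_int_fps_const [simp]: "of_int_fps (fps_const c) = fps_const (of_int c)"
  and of_int_fps_add: "of_int_fps (f + g) = of_int_fps f + of_int_fps g"
  and of_int_fps_diff: "of_int_fps (f - g) = of_int_fps f - of_int_fps g"
  and of_int_fps_mult: "of_int_fps (f * g) = of_int_fps f * of_int_fps g"
  and of_int_fps_of_poly [simp]: "of_int_fps (fps_of_poly p) = fps_of_poly (of_int_poly p)"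
  
  by (simp_all add: fps_eq_iff fps_mult_nth coeff_map_poly fps_X_def)

lemma of_int_fps_compose:
  "of_int_fps (fps_compose f (fps_X ^ d)) = fps_compose (of_int_fps f) (fps_X ^ d)"
  by (simp add: fps_eq_iff fps_nth_compose_X_power)

lemma of_int_fps_power: "of_int_fps (f ^ n) = of_int_fps f ^ n"
  by (induction n) (simp_all add: of_int_fps_mult)

lemma of_int_fps_sum: "of_int_fps (sum f A) = (\<Sum>a\<in>A. of_int_fps (f a))"
  by (induction A rule: infinite_finite_induct) (simp_all add: of_int_fps_add)

lemma of_int_fps_eq_iff [simp]:
  "of_int_fps f = (of_int_fps g :: 'a::ring_char_0 fps) \<longleftrightarrow> f = g"
  by (auto simp: fps_eq_iff)

lemma of_int_poly_mult: "of_int_poly (p * q) = (of_int_poly p * of_int_poly q :: 'a::comm_ring_1 poly)"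
  by (simp add: poly_eq_iff coeff_map_poly coeff_mult)

lemma of_int_poly_power: "of_int_poly (p ^ n) = (of_int_poly p ^ n :: 'a::comm_ring_1 poly)"
  by (induction n) (simp_all add: of_int_poly_mult)

lemma of_int_poly_add: "of_int_poly (p + q) = (of_int_poly p + of_int_poly q :: 'a::comm_ring_1 poly)"
  by (simp add: poly_eq_iff coeff_map_poly)

abbreviation fps_sq :: "'a::comm_ring_1 fps \<Rightarrow> 'a fps" where
  "fps_sq f \<equiv> fps_compose f (fps_X ^ 2)"

lemma fps_sq_nth: "fps_nth (fps_sq f) n = (if even n then fps_nth f (n div 2) else 0)"
  by (simp add: fps_nth_compose_X_power)

lemma fps_sq_mult: "fps_sq (f * g) = fps_sq f * fps_sq (g :: 'a::idom fps)"
  by (simp add: fps_compose_mult_distrib)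

lemma fps_sq_power: "fps_sq (f ^ n) = fps_sq (f :: 'a::idom fps) ^ n"
  by (simp add: fps_compose_power)

lemma fps_sq_of_poly: "fps_sq (fps_of_poly p) = fps_of_poly (pcompose p (monom 1 2))" for p :: "'a::idom poly"
  by (subst fps_of_poly_pcompose) (auto simp: fps_of_poly_monom')

lemma fps_bit_add_self [simp]: "f + f = (0 :: bit fps)"
  by (simp add: fps_eq_iff)

lemma fps_bit_2: "(2 :: bit fps) = 0"
  by (metis fps_bit_add_self one_add_one)

lemma bit_mult_self: "a * a = (a::bit)"
  by (cases a rule: bit.exhaust) simp_all

text \<open>Frobenius. Splitting off the constant term kills the cross term, since 2 = 0, and leaves
  the claim for the shifted series two places lower.\<close>

lemma fps_bit_square: "(f :: bit fps) ^ 2 = fps_sq f"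
proof -
  have "fps_nth (f ^ 2) n = fps_nth (fps_sq f) n" for n
  proof (induction n arbitrary: f rule: less_induct)
    case (less n)
    define g where "g = fps_shift 1 f"
    define c where "c = fps_nth f 0"
    have f: "f = fps_const c + fps_X * g"
      by (simp add: fps_eq_iff g_def c_def)
    have "f ^ 2 = fps_const c * fps_const c + fps_X ^ 2 * g ^ 2 + 2 * (fps_const c * fps_X * g)"
      by (subst f) (simp add: power2_eq_square algebra_simps del: fps_const_mult)
    also have "\<dots> = fps_const c + fps_X ^ 2 * g ^ 2"
      unfolding fps_const_mult bit_mult_self fps_bit_2 by simp
    finally have sq: "f ^ 2 = fps_const c + fps_X ^ 2 * g ^ 2" .
    show ?case
    proof (cases "n < 2")
      case True
      then have "n = 0 \<or> n = 1" by auto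
      then show ?thesis unfolding sq by (auto simp: fps_sq_nth c_def fps_X_power_mult_nth)
    next
      case False
      then obtain m where n: "n = Suc (Suc m)"
        by (metis One_nat_def Suc_1 add_2_eq_Suc le_Suc_ex not_less)
      have "fps_nth (f ^ 2) n = fps_nth (g ^ 2) m"
        unfolding sq n by (simp add: fps_X_power_mult_nth)
      also have "\<dots> = fps_nth (fps_sq g) m" by (intro less) (simp add: n)
      also have "\<dots> = fps_nth (fps_sq f) n"
        by (simp add: fps_sq_nth g_def n)
      finally show ?thesis .
    qed
  qed
  then show ?thesis by (simp add: fps_eq_iff)
qed

lemma of_int_bit_eq_0_iff: "of_int k = (0::bit) \<longleftrightarrow> even k"
proof
  assume "even k"
  then show "of_int k = (0::bit)" by (auto elim!: evenE)
next
  assume "of_int k = (0::bit)"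
  show "even k"
  proof (rule ccontr)
    assume "odd k"
    then have "of_int k = (1::bit)" by (auto elim!: oddE)
    then show False using \<open>of_int k = 0\<close> by simp
  qed
qed

section \<open>The functional equation and the reduction modulo 4\<close>

text \<open>The factors of the product are the values of \<open>factor_numerator u C D / D\<close> at \<open>z ^ 2 ^ n\<close>.\<close>

definition factor_numerator :: "int \<Rightarrow> int poly \<Rightarrow> int poly \<Rightarrow> int poly" where
  "factor_numerator u C D = [:1, u:] * D + [:0, 0, 2:] * C"

lemma fps_mult_nth_cong:
  assumes "\<And>i. i \<le> n \<Longrightarrow> fps_nth f i = fps_nth g i"
  shows "fps_nth (h * f) n = fps_nth (h * g) n"
  unfolding fps_mult_nth by (intro sum.cong) (auto simp: assms)

lemma mprod_fps_functional_eq: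
  fixes u :: int and C D :: "int poly"
  assumes D0: "coeff D 0 = 1"
  defines "f \<equiv> mprod_fps u C D"
  shows "fps_of_poly (of_int_poly D) * f = fps_of_poly (of_int_poly (factor_numerator u C D)) * fps_sq f"
    and "fps_nth f 0 = 1"
proof -
  define d c where "d = (fps_of_poly (of_int_poly D) :: real fps)"
    and "c = (fps_of_poly (of_int_poly C) :: real fps)"
  define a where "a = 1 + of_int u * fps_X + 2 * fps_X ^ 2 * c * inverse d"
  define P where "P = (\<lambda>k. \<Prod>n<k. fps_compose a (fps_X ^ (2 ^ n)))"
  have d0: "fps_nth d 0 = 1" by (simp add: d_def coeff_map_poly D0)
  have X0: "fps_nth (fps_X ^ (2 ^ n) :: real fps) 0 = 0" for n by simp
  have compose_X: "fps_compose fps_X (fps_X ^ (2 ^ n)) = (fps_X ^ (2 ^ n) :: real fps)" for n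
    by (simp add: fps_eq_iff fps_nth_compose_X_power)
  have compose_const: "fps_compose (of_int z) (fps_X ^ (2 ^ n)) = (of_int z :: real fps)" for n z
    by (metis fps_const_compose fps_of_int)
  have compose_two: "fps_compose 2 (fps_X ^ (2 ^ n)) = (2 :: real fps)" for n
    using compose_const[of 2 n] by simp
  have factor: "mfactor_fps u C D n = fps_compose a (fps_X ^ (2 ^ n))" for n
    unfolding a_def mfactor_fps_def d_def c_def
    by (simp add: fps_compose_add_distrib fps_compose_mult_distrib X0 compose_X compose_const compose_two
        fps_inverse_compose coeff_map_poly D0 fps_compose_power[symmetric] fps_of_poly_pcompose
        fps_of_poly_monom' flip: power_mult)
  have f_nth: "fps_nth f n = fps_nth (P (Suc n)) n" for n
    by (simp add: f_def mprod_fps_def factor P_def del: prod.lessThan_Suc)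
  \<comment> \<open>Coefficient \<open>n\<close> no longer changes once \<open>k > n\<close>: factor
    \<open>k\<close> differs from 1 only from order \<open>2 ^ k\<close> on.\<close>
  have P_step: "fps_nth (P (Suc k)) n = fps_nth (P k) n" if "n < k" for n k
  proof -
    have a0: "fps_nth a 0 = 1" by (simp add: a_def fps_of_int[symmetric])
    have "fps_nth (P k * fps_compose a (fps_X ^ (2 ^ k))) n = fps_nth (P k * 1) n"
    proof (rule fps_mult_nth_cong)
      fix i assume "i \<le> n"
      then have "i < 2 ^ k" using that less_exp[of k] by linarith
      then show "fps_nth (fps_compose a (fps_X ^ (2 ^ k))) i = fps_nth 1 i"
        by (auto simp: fps_nth_compose_X_power a0 dvd_def)
    qed
    then show ?thesis by (simp add: P_def mult.commute)
  qed
  have P_nth: "fps_nth (P k) n = fps_nth f n" if "n < k" for n k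
    using that
  proof (induction k)
    case (Suc k)
    then show ?case using P_step[of n k] f_nth[of n] by (cases "n < k") (auto simp: less_Suc_eq)
  qed auto
  have P_Suc: "P (Suc k) = a * fps_sq (P k)" for k
  proof -
    have "fps_compose a (fps_X ^ (2 ^ Suc n)) = fps_sq (fps_compose a (fps_X ^ (2 ^ n)))" for n
      by (auto simp: fps_eq_iff fps_nth_compose_X_power dvd_def div_mult2_eq)
    then show ?thesis
      unfolding P_def prod.lessThan_Suc_shift by (simp add: fps_compose_prod_distrib)
  qed
  have da: "d * a = fps_of_poly (of_int_poly (factor_numerator u C D))"
  proof -
    have "d * a = d * (1 + of_int u * fps_X) + 2 * fps_X ^ 2 * c * (inverse d * d)"
      by (simp add: a_def algebra_simps)
    also have "inverse d * d = 1" using d0 by (simp add: inverse_mult_eq_1)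
    finally have "d * a = d * (1 + of_int u * fps_X) + 2 * fps_X ^ 2 * c" by simp
    moreover have "(fps_of_poly (of_int_poly (factor_numerator u C D)) :: real fps) =
        fps_of_poly (of_int_poly ([:1, u:] * D)) + fps_of_poly (of_int_poly ([:0, 0, 2:] * C))"
      by (simp add: factor_numerator_def of_int_poly_add fps_of_poly_add)
    moreover have "(fps_of_poly (of_int_poly ([:1, u:] * D)) :: real fps) = d * (1 + of_int u * fps_X)"
      unfolding of_int_poly_mult fps_of_poly_mult d_def
      by (simp add: map_poly_pCons fps_of_poly_pCons fps_of_int[symmetric] mult.commute)
    moreover have "(fps_of_poly (of_int_poly ([:0, 0, 2:] * C)) :: real fps) = 2 * fps_X ^ 2 * c"
      unfolding of_int_poly_mult fps_of_poly_mult c_def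
      by (simp add: map_poly_pCons fps_of_poly_pCons power2_eq_square numeral_fps_const mult_ac)
    ultimately show ?thesis by (simp only:)
  qed
  \<comment> \<open>Finite products satisfy the equation only with a shift in the number of factors
    (\<open>P_Suc\<close>); with \<open>n + 2\<close> factors on the left and \<open>n + 1\<close>
    on the right, both sides are already stable up to order \<open>n\<close>.\<close>
  have "fps_nth (d * f) n = fps_nth (d * a * fps_sq f) n" for n
  proof -
    have "fps_nth (d * f) n = fps_nth (d * P (Suc (Suc n))) n"
      by (intro fps_mult_nth_cong) (simp add: P_nth)
    also have "\<dots> = fps_nth (d * a * fps_sq (P (Suc n))) n" by (simp only: P_Suc mult.assoc)
    also have "\<dots> = fps_nth (d * a * fps_sq f) n"
      by (intro fps_mult_nth_cong) (auto simp: fps_sq_nth P_nth)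
    finally show ?thesis .
  qed
  then have "d * f = d * a * fps_sq f" by (rule fps_ext)
  then show "fps_of_poly (of_int_poly D) * f = fps_of_poly (of_int_poly (factor_numerator u C D)) * fps_sq f"
    unfolding da by (simp only: d_def)
  show "fps_nth f 0 = 1"
    using f_nth[of 0] by (simp add: P_def a_def fps_of_int[symmetric])
qed

text \<open>As D has constant term 1, the functional equation expresses each later coefficient as an
  integer combination of earlier ones: coefficient n of \<open>fps_sq f\<close> involves index at
  most n / 2.\<close>

lemma mprod_fps_integral:
  assumes D0: "coeff D 0 = 1"
  obtains F :: "int fps" where "of_int_fps F = mprod_fps u C D" "fps_nth F 0 = 1"
    "fps_of_poly D * F = fps_of_poly (factor_numerator u C D) * fps_sq F"
proof -
  define f where "f = mprod_fps u C D"
  note eq = mprod_fps_functional_eq[OF D0, of u C, folded f_def]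
  have int: "fps_nth f n \<in> \<int>" for n
  proof (induction n rule: less_induct)
    case (less n)
    show ?case
    proof (cases "n = 0")
      case False
      have "fps_nth (fps_of_poly (of_int_poly D) * f) n =
          fps_nth f n + (\<Sum>i=1..n. of_int (coeff D i) * fps_nth f (n - i))"
        by (simp add: fps_mult_nth sum.atLeast_Suc_atMost coeff_map_poly D0)
      moreover have "(\<Sum>i=1..n. of_int (coeff D i) * fps_nth f (n - i)) \<in> \<int>"
        using False by (intro Ints_sum Ints_mult Ints_of_int less) auto
      moreover have "fps_nth (fps_of_poly (of_int_poly (factor_numerator u C D)) * fps_sq f) n \<in> \<int>"
        unfolding fps_mult_nth using False
        by (intro Ints_sum Ints_mult) (auto simp: coeff_map_poly fps_sq_nth intro!: less)
      ultimately show ?thesis using eq(1)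
        by (metis Ints_diff add_diff_cancel_right')
    qed (simp add: eq)
  qed
  define F where "F = Abs_fps (\<lambda>n. \<lfloor>fps_nth f n\<rfloor>)"
  have F: "of_int_fps F = f" using int by (simp add: fps_eq_iff F_def)
  have "of_int_fps (fps_of_poly D * F) = (of_int_fps (fps_of_poly (factor_numerator u C D) * fps_sq F) :: real fps)"
    using eq(1) by (simp add: of_int_fps_mult of_int_fps_compose F)
  then have "fps_of_poly D * F = fps_of_poly (factor_numerator u C D) * fps_sq F" by (simp only: of_int_fps_eq_iff)
  moreover have "fps_nth F 0 = 1" using eq(2) by (simp add: F_def)
  ultimately show ?thesis using that F f_def by blast
qed

lemma fps_of_poly_eq_0_iff [simp]: "fps_of_poly p = 0 \<longleftrightarrow> p = 0"
  using fps_of_poly_eq_iff[of p 0] by simp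

lemma bit_poly_lift:
  obtains P :: "int poly" where "of_int_poly P = (p :: bit poly)" "coeff p 0 = 1 \<Longrightarrow> coeff P 0 = 1"
proof -
  define P where "P = map_poly (\<lambda>b::bit. if b = 0 then 0 else 1 :: int) p"
  show ?thesis
    by (rule that[of P]) (auto simp: P_def poly_eq_iff coeff_map_poly)
qed

lemma rational_mod4I:
  assumes "coeff Q 0 = 1" "\<And>n. 4 dvd fps_nth (fps_of_poly Q * F - fps_of_poly P) n"
  shows "rational_mod4 (of_int_fps F)"
  unfolding rational_mod4_def
proof (rule exI[of _ P], rule exI[of _ Q], intro conjI allI)
  fix n
  obtain k where "fps_nth (fps_of_poly Q * F) n = coeff P n + 4 * k"
    using assms(2)[of n] by (auto simp: dvd_def algebra_simps)
  moreover have "fps_of_poly (of_int_poly Q) * of_int_fps F = (of_int_fps (fps_of_poly Q * F) :: real fps)"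
    by (simp add: of_int_fps_mult)
  ultimately show "\<exists>k. fps_nth (fps_of_poly (of_int_poly Q) * of_int_fps F) n
      = real_of_int (coeff P n) + 4 * real_of_int k"
    by (intro exI[of _ k]) simp
qed fact

lemma of_int_bit_fps_eq_iff:
  "of_int_fps F = (of_int_fps G :: bit fps) \<longleftrightarrow> (\<exists>H. F = G + 2 * H)"
proof
  assume eq: "of_int_fps F = (of_int_fps G :: bit fps)"
  have "even (fps_nth (F - G) n)" for n
  proof -
    have "of_int (fps_nth F n) = (of_int (fps_nth G n) :: bit)" by (metis eq of_int_fps_nth)
    then have "of_int (fps_nth F n - fps_nth G n) = (0 :: bit)" by (simp only: of_int_diff diff_self)
    then show ?thesis unfolding of_int_bit_eq_0_iff by simp
  qed
  then have "F = G + 2 * Abs_fps (\<lambda>n. fps_nth (F - G) n div 2)"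
    by (simp add: fps_eq_iff numeral_fps_const)
  then show "\<exists>H. F = G + 2 * H" by blast
next
  assume "\<exists>H. F = G + 2 * H"
  then show "of_int_fps F = (of_int_fps G :: bit fps)"
    by (auto simp: fps_eq_iff numeral_fps_const)
qed

section \<open>Bad approximability by rational functions\<close>

lemma degree_of_int_poly_le: "degree (of_int_poly p :: 'a::ring_1 poly) \<le> degree p"
  by (rule degree_le) (simp add: coeff_map_poly coeff_eq_0)

lemma degree_map_poly_le: "f 0 = 0 \<Longrightarrow> degree (map_poly f p) \<le> degree p"
  by (rule degree_le) (simp add: coeff_map_poly coeff_eq_0)

text \<open>The norm of \<open>q g - p\<close>, where the conjugate of \<open>g\<close> is \<open>-1 - g\<close>, times \<open>M\<close> is a nonzero polynomial
  of degree at most \<open>2 n + d\<close>.\<close>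

lemma quadratic_badly_approximable:
  fixes g :: "'a::idom fps" and M T p q :: "'a poly"
  assumes quad: "fps_of_poly M * (g + g ^ 2) = fps_of_poly T"
    and irr: "\<And>p q :: 'a poly. fps_of_poly q * g = fps_of_poly p \<Longrightarrow> q = 0"
    and M0: "M \<noteq> 0"
    and nz: "p \<noteq> 0 \<or> q \<noteq> 0" and deg: "degree p \<le> n" "degree q \<le> n"
    and d: "degree M \<le> d" "degree T \<le> d"
  shows "\<exists>i\<le>2 * n + d. fps_nth (fps_of_poly q * g - fps_of_poly p) i \<noteq> 0"
proof -
  have e_nz: "fps_of_poly q * g - fps_of_poly p \<noteq> 0" if "p \<noteq> 0 \<or> q \<noteq> 0" for p q
  proof
    assume "fps_of_poly q * g - fps_of_poly p = 0"
    then have eq: "fps_of_poly q * g = fps_of_poly p" by simp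
    then have "q = 0" by (rule irr)
    then show False using eq that by simp
  qed
  define e e' where "e = fps_of_poly q * g - fps_of_poly p"
    and "e' = fps_of_poly q * (- 1 - g) - fps_of_poly p"
  have e0: "e \<noteq> 0" unfolding e_def using nz by (rule e_nz)
  \<comment> \<open>The conjugate expression is, up to sign, again of the form
    \<open>q g - p'\<close> with \<open>p' = - p - q\<close>, so irrationality of \<open>g\<close>
    applies to it too.\<close>
  have e'0: "e' \<noteq> 0"
  proof -
    have "e' = - (fps_of_poly q * g - fps_of_poly (- p - q))"
      by (simp add: e'_def fps_of_poly_diff fps_of_poly_uminus algebra_simps)
    moreover have "fps_of_poly q * g - fps_of_poly (- p - q) \<noteq> 0" using nz by (intro e_nz) auto
    ultimately show ?thesis by simp
  qed
  define R where "R = M * (q * p + p ^ 2) - q ^ 2 * T"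
  have "fps_of_poly M * (e * e') = fps_of_poly M * (fps_of_poly q * fps_of_poly p + fps_of_poly p ^ 2)
      - fps_of_poly q ^ 2 * (fps_of_poly M * (g + g ^ 2))"
    by (simp add: e_def e'_def power2_eq_square algebra_simps)
  also have "\<dots> = fps_of_poly R"
    unfolding quad by (simp add: R_def fps_of_poly_add fps_of_poly_diff fps_of_poly_mult fps_of_poly_power)
  finally have prod: "fps_of_poly M * (e * e') = fps_of_poly R" .
  have M0': "fps_of_poly M \<noteq> 0" and "e * e' \<noteq> 0" using M0 e0 e'0 by simp_all
  then have "fps_of_poly R \<noteq> 0" unfolding prod[symmetric] by simp
  have "degree R \<le> 2 * n + d"
  proof -
    have "degree (q ^ 2 * T) \<le> 2 * n + d"
      using degree_mult_le[of "q ^ 2" T] degree_power_le[of q 2] deg d by linarith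
    moreover have "degree (M * (q * p + p ^ 2)) \<le> 2 * n + d"
    proof -
      have "degree (q * p + p ^ 2) \<le> 2 * n"
        using degree_mult_le[of q p] degree_power_le[of p 2] deg by (intro degree_add_le) linarith+
      then show ?thesis using degree_mult_le[of M "q * p + p ^ 2"] d by linarith
    qed
    ultimately show ?thesis unfolding R_def by (intro degree_diff_le)
  qed
  moreover have "subdegree (fps_of_poly R) \<le> degree R"
    using \<open>fps_of_poly R \<noteq> 0\<close> by (intro subdegree_leI) simp
  \<comment> \<open>Orders at 0 add and are nonnegative, so the order of \<open>e\<close> alone is
    at most the degree of \<open>R\<close>.\<close>
  moreover have "subdegree (fps_of_poly R) = subdegree (fps_of_poly M) + (subdegree e + subdegree e')"
    unfolding prod[symmetric] using M0' \<open>e * e' \<noteq> 0\<close> e0 e'0 by (simp del: fps_of_poly_eq_0_iff)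
  ultimately have "subdegree e \<le> 2 * n + d" by linarith
  moreover have "fps_nth e (subdegree e) \<noteq> 0" using e0 by simp
  ultimately show ?thesis unfolding e_def by blast
qed

text \<open>A nonzero integer pair may vanish modulo 2. It is then divisible by 2, and halving does
  not affect which coefficients of Q G - P are zero. The descent is on the size of the coefficients
  at one fixed index where the pair is nonzero, and it stops at a pair with nonzero reduction, where
  a coefficient nonzero modulo 2 is nonzero.\<close>

lemma mod2_badly_approximable_lift:
  fixes G :: "int fps"
  assumes bad: "\<And>p q :: bit poly. p \<noteq> 0 \<or> q \<noteq> 0 \<Longrightarrow> degree p \<le> n \<Longrightarrow> degree q \<le> n \<Longrightarrow>
      \<exists>i\<le>k. fps_nth (fps_of_poly q * of_int_fps G - fps_of_poly p) i \<noteq> 0"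
    and nz: "P \<noteq> 0 \<or> Q \<noteq> 0" and deg: "degree P \<le> n" "degree Q \<le> n"
  shows "\<exists>i\<le>k. fps_nth (fps_of_poly Q * G - fps_of_poly P) i \<noteq> 0"
proof -
  obtain j where "coeff P j \<noteq> 0 \<or> coeff Q j \<noteq> 0"
    using nz by (auto simp: poly_eq_iff)
  then show ?thesis using deg
  proof (induction "nat \<bar>coeff P j\<bar> + nat \<bar>coeff Q j\<bar>" arbitrary: P Q rule: less_induct)
    case less
    show ?case
    proof (cases "of_int_poly P = (0 :: bit poly) \<and> of_int_poly Q = (0 :: bit poly)")
      case True
      define P' Q' where "P' = map_poly (\<lambda>c. c div 2) P" and "Q' = map_poly (\<lambda>c. c div 2) Q"
      have ev: "even (coeff P i)" "even (coeff Q i)" for i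
        unfolding of_int_bit_eq_0_iff[symmetric] using True
        by (metis coeff_0 coeff_map_poly of_int_0)+
      have P': "coeff P i = 2 * coeff P' i" and Q': "coeff Q i = 2 * coeff Q' i" for i
        using ev by (simp_all add: P'_def Q'_def coeff_map_poly)
      have "nat \<bar>coeff P' j\<bar> + nat \<bar>coeff Q' j\<bar> < nat \<bar>coeff P j\<bar> + nat \<bar>coeff Q j\<bar>"
        using less.prems(1) P'[of j] Q'[of j] by linarith
      moreover have "coeff P' j \<noteq> 0 \<or> coeff Q' j \<noteq> 0" using less.prems(1) P'[of j] Q'[of j] by linarith
      moreover have "degree P' \<le> n" "degree Q' \<le> n"
        using less.prems(2,3) degree_map_poly_le[of "\<lambda>c. c div 2" P] degree_map_poly_le[of "\<lambda>c. c div 2" Q]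
        unfolding P'_def Q'_def by simp_all
      ultimately obtain i where "i \<le> k" "fps_nth (fps_of_poly Q' * G - fps_of_poly P') i \<noteq> 0"
        using less.hyps[of P' Q'] by blast
      moreover have QP: "fps_of_poly Q = fps_const 2 * fps_of_poly Q'" "fps_of_poly P = fps_const 2 * fps_of_poly P'"
        using P' Q' by (simp_all add: fps_eq_iff)
      have "fps_of_poly Q * G - fps_of_poly P = fps_const 2 * (fps_of_poly Q' * G - fps_of_poly P')"
        unfolding QP by (simp only: algebra_simps)
      ultimately show ?thesis by auto
    next
      case False
      moreover have "degree (of_int_poly P :: bit poly) \<le> n" "degree (of_int_poly Q :: bit poly) \<le> n"
        using less.prems(2,3) degree_of_int_poly_le order_trans by blast+
      ultimately obtain i where "i \<le> k"
        "fps_nth (fps_of_poly (of_int_poly Q) * of_int_fps G - fps_of_poly (of_int_poly P) :: bit fps) i \<noteq> 0"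
        using bad[of "of_int_poly P" "of_int_poly Q"] by blast
      moreover have "fps_of_poly (of_int_poly Q) * of_int_fps G - fps_of_poly (of_int_poly P)
          = (of_int_fps (fps_of_poly Q * G - fps_of_poly P) :: bit fps)"
        by (simp add: of_int_fps_mult of_int_fps_diff)
      ultimately have "fps_nth (of_int_fps (fps_of_poly Q * G - fps_of_poly P) :: bit fps) i \<noteq> 0"
        by metis
      then have "fps_nth (fps_of_poly Q * G - fps_of_poly P) i \<noteq> 0"
        unfolding of_int_fps_nth of_int_bit_eq_0_iff by fastforce
      then show ?thesis using \<open>i \<le> k\<close> by blast
    qed
  qed
qed

text \<open>The point is that \<open>c\<close> does not depend on \<open>n\<close>. Linear algebra
  yields approximants of order greater than 2 n, so their exact order is known up to a bounded
  error.\<close>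

lemma badly_approximable:
  fixes F :: "int fps"
  assumes D0: "coeff D 0 = 1" and F0: "fps_nth F 0 = 1"
    and feq: "fps_of_poly D * F = fps_of_poly (factor_numerator u C D) * fps_sq F"
    and nr: "\<not> rational_mod4 (of_int_fps F)"
  obtains c where "\<forall>P Q n. P \<noteq> 0 \<or> Q \<noteq> 0 \<longrightarrow> degree P \<le> n \<longrightarrow> degree Q \<le> n \<longrightarrow>
      (\<exists>i\<le>2 * n + c. fps_nth (fps_of_poly Q * F - fps_of_poly P) i \<noteq> 0)"
proof -
  define w v where "w = u mod 2" and "v = u div 2"
  have u: "u = w + 2 * v" by (simp add: w_def v_def)
  have w01: "w = 0 \<or> w = 1" unfolding w_def by auto
  define L where "L = [:1, -w:]"
  define L' where "L' = [:1, 0, -w:]"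
  define T where "T = [:0, v:] * L * D + [:0, 0, 1:] * C * L"
  define M where "M = D * L'"
  define l where "l = (fps_of_poly L :: int fps)"
  define N where "N = factor_numerator u C D"
  \<comment> \<open>This rests on \<open>w ^ 2 = w\<close>. It makes \<open>N * L\<close> congruent
    to \<open>D\<close> times \<open>L\<close> at z^2 modulo 2, and \<open>T\<close> is half of the
    difference.\<close>
  have uL: "[:1, u:] * L = L' + 2 * ([:0, v:] * L)"
    using w01
  proof
    assume "w = 0"
    then show ?thesis by (simp add: L_def L'_def u numeral_poly)
  next
    assume "w = 1"
    then show ?thesis by (simp add: L_def L'_def u numeral_poly)
  qed
  have "N * L = D * ([:1, u:] * L) + [:0, 0, 2:] * C * L"
    by (simp add: N_def factor_numerator_def algebra_simps)
  also have "[:0, 0, 2:] = 2 * [:0, 0, 1 :: int:]" by (simp add: numeral_poly)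
  also have "D * ([:1, u:] * L) + 2 * [:0, 0, 1:] * C * L = M + 2 * T"
    unfolding uL by (simp add: T_def M_def algebra_simps)
  finally have NL: "N * L = M + 2 * T" .
  have "pcompose L (monom 1 2) = L'"
    by (simp add: L_def L'_def pcompose_pCons monom_altdef power2_eq_square)
  then have lsq: "fps_sq l = fps_of_poly L'" by (simp add: l_def fps_sq_of_poly)
  let ?b = "of_int_fps :: int fps \<Rightarrow> bit fps"
  \<comment> \<open>Modulo 2 the numerator \<open>N\<close> is \<open>L * D\<close>, so the
    reduction satisfies f = L f^2; cancelling f leaves 1 = L f.\<close>
  have "?b (l * F) = ?b 1"
  proof -
    let ?f = "?b F" and ?d = "?b (fps_of_poly D)"
    have N_eq: "?b (fps_of_poly N) = ?b l * ?d"
    proof -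
      have lin: "[:1, u:] = L + 2 * [:0, w + v:]" by (simp add: L_def u numeral_poly)
      have quad: "[:0, 0, 2:] = 2 * [:0, 0, 1 :: int:]" by (simp add: numeral_poly)
      have "N = L * D + 2 * ([:0, w + v:] * D + [:0, 0, 1:] * C)"
        unfolding N_def factor_numerator_def lin quad by (simp only: distrib_left distrib_right mult.assoc add.assoc)
      then have "fps_of_poly N = l * fps_of_poly D + 2 * fps_of_poly ([:0, w + v:] * D + [:0, 0, 1:] * C)"
        by (simp only: fps_of_poly_add fps_of_poly_mult fps_of_poly_numeral l_def)
      then show ?thesis unfolding of_int_fps_mult[symmetric] of_int_bit_fps_eq_iff by blast
    qed
    have "?d * ?f = ?b (fps_of_poly N) * fps_sq ?f"
      unfolding of_int_fps_mult[symmetric] of_int_fps_compose[symmetric] feq N_def ..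
    also have "\<dots> = ?d * (?b l * ?f ^ 2)"
      unfolding N_eq fps_bit_square[symmetric] by (simp only: mult_ac)
    finally have d_eq: "?d * ?f = ?d * (?b l * ?f ^ 2)" .
    have "fps_nth ?d 0 \<noteq> 0" using D0 by (simp add: coeff_map_poly)
    then have d_nz: "?d \<noteq> 0" by (metis fps_zero_nth)
    have "?f = ?b l * ?f ^ 2" by (rule mult_left_cancel[OF d_nz, THEN iffD1, OF d_eq])
    also have "\<dots> = ?f * (?b l * ?f)" by (simp only: power2_eq_square mult_ac)
    finally have f_eq: "?f * 1 = ?f * (?b l * ?f)" by (simp only: mult_1_right)
    have "fps_nth ?f 0 \<noteq> 0" using F0 by simp
    then have f_nz: "?f \<noteq> 0" by (metis fps_zero_nth)
    have "1 = ?b l * ?f" by (rule mult_left_cancel[OF f_nz, THEN iffD1, OF f_eq])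
    then show ?thesis unfolding of_int_fps_mult of_int_fps_1 by (rule sym)
  qed
  then obtain G where G: "l * F = 1 + 2 * G"
    unfolding of_int_bit_fps_eq_iff by blast
  have sqG: "fps_of_poly L' * fps_sq F = 1 + 2 * fps_sq G"
    using arg_cong[OF G, of fps_sq] by (simp add: fps_sq_mult lsq fps_compose_add_distrib numeral_fps_const)
  define g where "g = ?b G"
  have "fps_of_poly M * (1 + 2 * G) = (fps_of_poly D * F) * (l * fps_of_poly L')"
    unfolding G[symmetric] by (simp add: M_def fps_of_poly_mult mult_ac)
  also have "\<dots> = (fps_of_poly N * l) * (fps_of_poly L' * fps_sq F)"
    unfolding feq by (simp add: N_def mult_ac)
  also have "\<dots> = (fps_of_poly M + 2 * fps_of_poly T) * (1 + 2 * fps_sq G)"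
    unfolding sqG l_def fps_of_poly_mult[symmetric] NL by (simp add: fps_of_poly_add fps_of_poly_mult)
  finally have "2 * (fps_of_poly M * G) = 2 * (fps_of_poly M * fps_sq G + fps_of_poly T * (1 + 2 * fps_sq G))"
    by (simp add: algebra_simps)
  then have "fps_of_poly M * G = fps_of_poly M * fps_sq G + fps_of_poly T * (1 + 2 * fps_sq G)"
    by (rule mult_left_cancel[THEN iffD1, rotated]) (simp add: numeral_fps_const)
  then have "fps_of_poly M * G = fps_of_poly M * fps_sq G + fps_of_poly T + 2 * (fps_of_poly T * fps_sq G)"
    by (simp add: algebra_simps)
  then have "?b (fps_of_poly M * G) = ?b (fps_of_poly M * fps_sq G + fps_of_poly T)"
    unfolding of_int_bit_fps_eq_iff by blast
  then have "fps_of_poly (of_int_poly M) * g = fps_of_poly (of_int_poly M) * g ^ 2 + fps_of_poly (of_int_poly T)"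
    by (simp add: of_int_fps_mult of_int_fps_add of_int_fps_compose fps_bit_square[symmetric] g_def)
  then have "fps_of_poly (of_int_poly M) * g + fps_of_poly (of_int_poly M) * g ^ 2 = fps_of_poly (of_int_poly T)
      + (fps_of_poly (of_int_poly M) * g ^ 2 + fps_of_poly (of_int_poly M) * g ^ 2)"
    by (simp only: add_ac)
  then have quad: "fps_of_poly (of_int_poly M) * (g + g ^ 2) = fps_of_poly (of_int_poly T)"
    by (simp only: fps_bit_add_self distrib_left add_0_right)
  \<comment> \<open>\<open>rational_mod4\<close> asks for a denominator with constant term 1. If
    \<open>q\<close> has constant term 1, lifting \<open>q g = p\<close> gives the denominator
    \<open>L * Q\<close> for F: an identity for G modulo 2 is one for \<open>2 * G\<close> modulo 4.
    Otherwise a factor z cancels, which is the induction step.\<close>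
  have irr: "q = 0" if "fps_of_poly q * g = fps_of_poly p" for p q
    using that
  proof (induction q arbitrary: p)
    case (pCons a q)
    have a0: "a = 0"
    proof (rule ccontr)
      assume "a \<noteq> 0"
      then have "coeff (pCons a q) 0 = 1" by simp
      then obtain Q where Q: "of_int_poly Q = pCons a q" "coeff Q 0 = 1" using bit_poly_lift by blast
      obtain P where P: "of_int_poly P = p" using bit_poly_lift by blast
      have "?b (fps_of_poly Q * G) = ?b (fps_of_poly P)"
        using pCons.prems Q P by (simp add: of_int_fps_mult g_def)
      then obtain H where H: "fps_of_poly Q * G = fps_of_poly P + 2 * H"
        unfolding of_int_bit_fps_eq_iff by blast
      have "fps_of_poly (L * Q) * F - fps_of_poly (Q + 2 * P) =
          fps_of_poly Q * (l * F) - fps_of_poly (Q + 2 * P)"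
        by (simp add: l_def fps_of_poly_mult mult_ac)
      also have "\<dots> = 2 * (fps_of_poly Q * G) - 2 * fps_of_poly P"
        unfolding G by (simp add: fps_of_poly_add fps_of_poly_mult algebra_simps)
      also have "\<dots> = fps_const 4 * H" unfolding H by (simp add: numeral_fps_const[symmetric])
      finally have eq4: "fps_of_poly (L * Q) * F - fps_of_poly (Q + 2 * P) = fps_const 4 * H" .
      have "4 dvd fps_nth (fps_of_poly (L * Q) * F - fps_of_poly (Q + 2 * P)) n" for n
        unfolding eq4 by simp
      moreover have "coeff (L * Q) 0 = 1" using Q by (simp add: coeff_mult L_def)
      ultimately have "rational_mod4 (of_int_fps F)" by (rule rational_mod4I[rotated])
      then show False using nr by simp
    qed
    have "fps_X * (fps_of_poly q * g) = fps_of_poly p"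
      using pCons.prems by (simp add: a0 fps_of_poly_pCons mult_ac)
    then have "fps_of_poly q * g = fps_shift 1 (fps_of_poly p)"
      using fps_shift_times_fps_X'[of "fps_of_poly q * g"] by (simp only: mult.commute)
    also have "\<dots> = fps_of_poly (poly_shift 1 p)" by simp
    finally have "q = 0" by (rule pCons.IH)
    then show ?case using a0 by simp
  qed simp
  define d where "d = max (degree M) (degree T)"
  have M0: "of_int_poly M \<noteq> (0 :: bit poly)"
  proof -
    have "coeff (of_int_poly M :: bit poly) 0 = 1"
      by (simp add: coeff_map_poly M_def coeff_mult D0 L'_def)
    then show ?thesis by (metis coeff_0 zero_neq_one)
  qed
  have badG: "\<exists>i\<le>2 * n + d. fps_nth (fps_of_poly Q * G - fps_of_poly P) i \<noteq> 0"
    if "P \<noteq> 0 \<or> Q \<noteq> 0" "degree P \<le> n" "degree Q \<le> n" for P Q n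
  proof (rule mod2_badly_approximable_lift[OF _ that])
    fix p q :: "bit poly" assume pq: "p \<noteq> 0 \<or> q \<noteq> 0" "degree p \<le> n" "degree q \<le> n"
    have "degree (of_int_poly M :: bit poly) \<le> d" "degree (of_int_poly T :: bit poly) \<le> d"
      using degree_of_int_poly_le[where ?'a = bit, of M] degree_of_int_poly_le[where ?'a = bit, of T]
      unfolding d_def by linarith+
    then show "\<exists>i\<le>2 * n + d. fps_nth (fps_of_poly q * ?b G - fps_of_poly p) i \<noteq> 0"
      unfolding g_def[symmetric] by (intro quadratic_badly_approximable[OF quad irr M0 pq])
  qed
  have L0: "L \<noteq> 0" by (simp add: L_def)
  show ?thesis
  proof (rule that[of "d + 2"], intro allI impI)
    fix P Q :: "int poly" and n
    assume nz: "P \<noteq> 0 \<or> Q \<noteq> 0" and deg: "degree P \<le> n" "degree Q \<le> n"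
    \<comment> \<open>Since \<open>L (Q F - P) = 2 Q G - (P L - Q)\<close>, a pair of degree n for F
      becomes one of degree n + 1 for G, and 2 (n + 1) + d explains the constant
      \<open>d + 2\<close>.\<close>
    have "degree L \<le> 1" by (simp add: L_def)
    then have "degree (P * L) \<le> Suc n" using degree_mult_le[of P L] deg by linarith
    then have "degree (P * L - Q) \<le> Suc n" using deg by (intro degree_diff_le) auto
    moreover have "degree (2 * Q) \<le> Suc n" using deg degree_mult_le[of 2 Q] by simp
    moreover have "P * L - Q \<noteq> 0 \<or> 2 * Q \<noteq> 0" using nz L0 by auto
    ultimately obtain i where i: "i \<le> 2 * Suc n + d"
      "fps_nth (fps_of_poly (2 * Q) * G - fps_of_poly (P * L - Q)) i \<noteq> 0"
      using badG by blast
    have "fps_of_poly (2 * Q) * G - fps_of_poly (P * L - Q) = fps_of_poly Q * (1 + 2 * G) - l * fps_of_poly P"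
      by (simp add: fps_of_poly_mult fps_of_poly_diff l_def algebra_simps)
    also have "\<dots> = l * (fps_of_poly Q * F - fps_of_poly P)"
      unfolding G[symmetric] by (simp add: algebra_simps)
    finally have "fps_nth (l * (fps_of_poly Q * F - fps_of_poly P)) i \<noteq> 0" using i by simp
    then obtain j where "j \<le> i" "fps_nth (fps_of_poly Q * F - fps_of_poly P) j \<noteq> 0"
      using fps_mult_nth_cong[of i "fps_of_poly Q * F - fps_of_poly P" 0 l] by auto
    then show "\<exists>i\<le>2 * n + (d + 2). fps_nth (fps_of_poly Q * F - fps_of_poly P) i \<noteq> 0"
      using i by (intro exI[of _ j]) simp
  qed
qed

section \<open>Transcendence of the series\<close>

lemma fps_sq_eq_0_iff [simp]: "fps_sq f = 0 \<longleftrightarrow> f = (0 :: 'a::idom fps)"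
  by (subst fps_compose_eq_0_iff) auto

lemma subdegree_fps_sq: "subdegree (fps_sq f) = 2 * subdegree (f :: 'a::idom fps)"
proof (cases "f = 0")
  case False
  show ?thesis
  proof (rule subdegreeI)
    fix i assume "i < 2 * subdegree f"
    then show "fps_nth (fps_sq f) i = 0" by (auto simp: fps_sq_nth elim!: evenE)
  qed (use False in \<open>simp add: fps_sq_nth\<close>)
qed simp

text \<open>A quotient U / V invariant under z -> z^2 is constant. Comparing orders, every nonzero
  solution W of the same linear relation has the order of V; the combination of U and V whose
  coefficient at that order cancels must therefore be 0.\<close>

lemma fps_sq_proportional:
  fixes U V :: "'a::idom fps"
  assumes eq: "U * fps_sq V = fps_sq U * V" and V: "V \<noteq> 0"
  obtains c c' where "c \<noteq> 0" "fps_const c * U = fps_const c' * V"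
proof (cases "U = 0")
  case True
  then show ?thesis using that[of 1 0] by simp
next
  case False
  have subdeg: "subdegree W = subdegree V" if "W * fps_sq V = fps_sq W * V" "W \<noteq> 0" for W
    using arg_cong[OF that(1), of subdegree] that(2) V by (simp add: subdegree_fps_sq)
  define c c' where "c = fps_nth V (subdegree V)" and "c' = fps_nth U (subdegree V)"
  define W where "W = fps_const c * U - fps_const c' * V"
  have "W = 0"
  proof (rule ccontr)
    assume W0: "W \<noteq> 0"
    have "W * fps_sq V = fps_const c * (U * fps_sq V) - fps_const c' * V * fps_sq V"
      by (simp add: W_def algebra_simps)
    also have "\<dots> = fps_sq W * V"
      unfolding eq by (simp add: W_def fps_compose_sub_distrib fps_sq_mult algebra_simps)
    finally have "subdegree W = subdegree V" using W0 by (rule subdeg)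
    moreover have "fps_nth W (subdegree V) = 0" by (simp add: W_def c_def c'_def mult.commute)
    ultimately show False using W0 nth_subdegree_nonzero[of W] by simp
  qed
  moreover have "c \<noteq> 0" using V by (simp add: c_def)
  ultimately show ?thesis using that by (simp add: W_def)
qed

text \<open>Over the integral domain of complex series, the polynomial X^k - g^k has at most k
  roots, and the k multiples of g by roots of unity are already that many.\<close>

lemma fps_eq_const_mult_of_power_eq:
  fixes f g :: "complex fps"
  assumes eq: "f ^ k = g ^ k" and k: "k > 0"
  obtains w where "f = fps_const w * g"
proof (cases "g = 0")
  case True
  then show ?thesis using eq k that[of 0] by (simp add: power_0_left)
next
  case False
  define p where "p = monom 1 k - [:g ^ k:]"
  define A where "A = (\<lambda>w. fps_const w * g) ` {w. w ^ k = 1}"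
  have "coeff p k = 1" using k by (cases k) (auto simp: p_def)
  then have p0: "p \<noteq> 0" by auto
  have "degree p \<le> k" unfolding p_def using k by (intro degree_diff_le) (auto simp: degree_monom_le)
  then have card: "card {x. poly p x = 0} \<le> k"
    using card_poly_roots_bound[OF p0] by linarith
  have fin: "finite {x. poly p x = 0}" using p0 by (rule poly_roots_finite)
  have "A \<subseteq> {x. poly p x = 0}"
    by (auto simp: A_def p_def poly_monom power_mult_distrib fps_const_power)
  moreover have "card A = k"
    unfolding A_def using False k
    by (subst card_image) (auto simp: inj_on_def card_roots_unity_eq)
  ultimately have "A = {x. poly p x = 0}"
    using fin card by (intro card_seteq) auto
  moreover have "f \<in> {x. poly p x = 0}" using eq by (simp add: p_def poly_monom)
  ultimately show ?thesis using that by (auto simp: A_def)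
qed

lemma pcompose_power: "pcompose (p ^ n) q = pcompose p q ^ n" for p :: "'a::comm_ring_1 poly"
proof (induction n)
  case 0
  show ?case using pcompose_const[of 1 q] by (simp add: one_pCons)
qed (simp add: pcompose_mult)

lemma order_power: "p \<noteq> 0 \<Longrightarrow> order z (p ^ n) = n * order z p" for p :: "'a::idom poly"
  by (induction n) (simp_all add: order_mult)

text \<open>From t^2 - z^2 = (t - z)(t + z): squaring is unramified away from 0 and doubles the
  order at 0.\<close>

lemma order_pcompose_square:
  fixes h :: "complex poly"
  assumes h: "h \<noteq> 0"
  shows "order z (pcompose h (monom 1 2)) = (if z = 0 then 2 * order 0 h else order (z\<^sup>2) h)"
proof -
  define m where "m = order (z\<^sup>2) h"
  obtain q where q: "h = [:- (z\<^sup>2), 1:] ^ m * q" "\<not> [:- (z\<^sup>2), 1:] dvd q"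
    using order_decomp[OF h, of "z\<^sup>2"] m_def by blast
  have qz: "poly q (z\<^sup>2) \<noteq> 0" using q(2) by (simp add: poly_eq_0_iff_dvd)
  define r where "r = pcompose q (monom 1 2)"
  have rz: "poly r z \<noteq> 0" using qz by (simp add: r_def poly_pcompose poly_monom)
  then have r0: "r \<noteq> 0" by auto
  have factor: "pcompose [:- (z\<^sup>2), 1:] (monom 1 2) = [:- z, 1:] * [:z, 1:]"
    by (simp add: pcompose_pCons monom_altdef power2_eq_square)
  then have eq: "pcompose h (monom 1 2) = [:- z, 1:] ^ m * ([:z, 1:] ^ m * r)"
    unfolding q(1) pcompose_mult pcompose_power factor r_def by (simp only: power_mult_distrib mult_ac)
  have "order z ([:- z, 1:] ^ m * ([:z, 1:] ^ m * r)) =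
      order z ([:- z, 1:] ^ m) + (order z ([:z, 1:] ^ m) + order z r)"
    using r0 by (subst order_mult, simp, subst order_mult) simp_all
  also have "order z ([:- z, 1:] ^ m) = m" by (rule order_power_n_n)
  also have "order z r = 0" using rz by (rule order_0I)
  also have "order z ([:z, 1:] ^ m) = (if z = 0 then m else 0)"
  proof (cases "z = 0")
    case True
    then show ?thesis using order_power_n_n[of 0 m] by simp
  next
    case False
    then have "poly ([:z, 1:] ^ m) z \<noteq> 0" by simp
    then show ?thesis using False by (simp add: order_0I)
  qed
  finally show ?thesis unfolding eq using m_def by (auto simp: zero_power2)
qed

text \<open>A root \<open>w\<close> of \<open>h\<close> whose order is not divisible by \<open>k\<close> would have all its iterated square roots as
  further roots.\<close>

lemma dvd_order_of_square_functional_eq: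
  fixes h B E :: "complex poly"
  assumes eq: "h * B ^ k = pcompose h (monom 1 2) * E ^ k"
    and nz: "h \<noteq> 0" "B \<noteq> 0" "E \<noteq> 0"
  shows "k dvd order z h"
proof -
  have comp_nz: "pcompose h (monom 1 2) \<noteq> 0"
    using nz by (auto simp: pcompose_eq_0_iff degree_monom_eq)
  have ord: "order z h + k * order z B = order z (pcompose h (monom 1 2)) + k * order z E" for z
  proof -
    have "order z (h * B ^ k) = order z (pcompose h (monom 1 2) * E ^ k)" by (simp only: eq)
    then show ?thesis using nz comp_nz by (simp add: order_mult order_power)
  qed
  show ?thesis
  proof (cases "z = 0")
    case True
    \<comment> \<open>At 0 there are no distinct square roots to count, but the order doubles there,
      and the equation gives divisibility at once.\<close>
    have "order 0 h + k * order 0 B = 2 * order 0 h + k * order 0 E"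
      using ord[of 0] order_pcompose_square[OF nz(1), of 0] by simp
    then have "k * order 0 B = order 0 h + k * order 0 E" by simp
    then have "k dvd order 0 h" by (metis dvd_add_times_triv_right_iff dvd_triv_left mult.commute)
    then show ?thesis using True by simp
  next
    case False
    have step: "k dvd order (w\<^sup>2) h" if "k dvd order w h" "w \<noteq> 0" for w
    proof -
      have "order w h + k * order w B = order (w\<^sup>2) h + k * order w E"
        using ord[of w] order_pcompose_square[OF nz(1), of w] that by simp
      then show ?thesis using that(1)
        by (metis dvd_add_times_triv_right_iff mult.commute)
    qed
    have steps: "k dvd order (w ^ (2 ^ i)) h" if "k dvd order w h" "w \<noteq> 0" for w i
      using that
    proof (induction i)
      case (Suc i)
      then have "k dvd order ((w ^ (2 ^ i))\<^sup>2) h" by (intro step) auto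
      then show ?case by (simp add: power_mult[symmetric] mult.commute)
    qed simp
    show ?thesis
    proof (rule ccontr)
      assume ndvd: "\<not> k dvd order z h"
      \<comment> \<open>The \<open>2 ^ i\<close> iterated roots must outnumber the at most
        \<open>degree h\<close> roots of \<open>h\<close>; \<open>i = degree h\<close> is
        enough.\<close>
      let ?i = "degree h"
      have "{w. w ^ (2 ^ ?i) = z} \<subseteq> {w. poly h w = 0}"
      proof
        fix w assume "w \<in> {w. w ^ (2 ^ ?i) = z}"
        then have w: "w ^ (2 ^ ?i) = z" by simp
        then have "w \<noteq> 0" using False by (auto simp: power_0_left)
        then have "\<not> k dvd order w h" using steps[of w ?i] w ndvd by auto
        then have "order w h \<noteq> 0" by (metis dvd_0_right)
        then show "w \<in> {w. poly h w = 0}" using nz(1) by (simp add: order_root)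
      qed
      then have "card {w. w ^ (2 ^ ?i) = z} \<le> card {w. poly h w = 0}"
        using poly_roots_finite[OF nz(1)] by (rule card_mono[rotated])
      moreover have "card {w. w ^ (2 ^ ?i) = z} = 2 ^ ?i"
        using False by (intro card_nth_roots) auto
      moreover have "card {w. poly h w = 0} \<le> ?i" using nz(1) by (rule card_poly_roots_bound)
      ultimately show False using less_exp[of ?i] by linarith
    qed
  qed
qed

text \<open>By the functional equation all root orders of \<open>h\<close> are divisible by
  \<open>k\<close>, so over the complex numbers \<open>h\<close> is a constant times a k-th power
  \<open>s ^ k\<close>, and G is a constant multiple of \<open>s\<close>. As the coefficients of G
  beyond the degree of \<open>s\<close> vanish, G is a polynomial over the integers as well.\<close>

lemma fps_is_poly_of_power:
  fixes G :: "int fps" and h B E :: "int poly"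
  assumes pow: "fps_const c * G ^ k = fps_of_poly h" and c: "c \<noteq> 0" and k: "k > 0" and G0: "G \<noteq> 0"
    and feq: "G * fps_of_poly B = fps_sq G * fps_of_poly E" and nz: "B \<noteq> 0" "E \<noteq> 0"
  obtains p where "G = fps_of_poly p"
proof -
  let ?c = "of_int_poly :: int poly \<Rightarrow> complex poly"
  have h0: "h \<noteq> 0" using pow c G0 by (metis fps_const_eq_0_iff fps_of_poly_0 mult_eq_0_iff power_not_zero)
  have "fps_of_poly (h * B ^ k) = fps_const c * (G * fps_of_poly B) ^ k"
    by (simp add: fps_of_poly_mult fps_of_poly_power pow[symmetric] power_mult_distrib mult_ac)
  also have "\<dots> = fps_sq (fps_const c * G ^ k) * fps_of_poly E ^ k"
    unfolding feq by (simp add: fps_sq_mult fps_sq_power power_mult_distrib mult_ac)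
  also have "\<dots> = fps_of_poly (pcompose h (monom 1 2) * E ^ k)"
    unfolding pow fps_sq_of_poly by (simp add: fps_of_poly_mult fps_of_poly_power)
  finally have eq: "h * B ^ k = pcompose h (monom 1 2) * E ^ k" by (simp only: fps_of_poly_eq_iff)
  have comp: "?c (pcompose h (monom 1 2)) = pcompose (?c h) (monom 1 2)"
  proof -
    have "fps_of_poly (?c (pcompose h (monom 1 2))) = fps_of_poly (pcompose (?c h) (monom 1 2))"
      by (simp only: of_int_fps_of_poly[symmetric] fps_sq_of_poly[symmetric] of_int_fps_compose)
    then show ?thesis by (simp only: fps_of_poly_eq_iff)
  qed
  have nzc: "?c p \<noteq> 0" if "p \<noteq> 0" for p
    using that by (simp add: map_poly_eq_0_iff)
  have "?c h * ?c B ^ k = pcompose (?c h) (monom 1 2) * ?c E ^ k"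
    using arg_cong[OF eq, of ?c] by (simp only: of_int_poly_mult of_int_poly_power comp)
  then have dvd: "k dvd order z (?c h)" for z
    using nzc[OF h0] nzc[OF nz(1)] nzc[OF nz(2)] by (rule dvd_order_of_square_functional_eq)
  define s where "s = (\<Prod>z | poly (?c h) z = 0. [:- z, 1:] ^ (order z (?c h) div k))"
  define a where "a = lead_coeff (?c h)"
  have "s ^ k = (\<Prod>z | poly (?c h) z = 0. [:- z, 1:] ^ order z (?c h))"
    unfolding s_def prod_power_distrib power_mult[symmetric]
    by (intro prod.cong refl) (simp add: dvd)
  then have hs: "?c h = smult a (s ^ k)"
    unfolding a_def using complex_poly_decompose[of "?c h"] by simp
  obtain m where m: "m ^ k = a / of_int c"
    using exists_complex_root[of k "a / of_int c"] k by (metis neq0_conv)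
  have "fps_const (of_int c) * of_int_fps G ^ k = fps_of_poly (?c h)"
    using arg_cong[OF pow, of "of_int_fps :: _ \<Rightarrow> complex fps"]
    by (simp only: of_int_fps_mult of_int_fps_power of_int_fps_const of_int_fps_of_poly)
  also have "\<dots> = fps_const (of_int c) * fps_const (m ^ k) * fps_of_poly s ^ k"
    using c by (simp add: hs m fps_of_poly_smult fps_of_poly_power)
  finally have "of_int_fps G ^ k = (fps_const m * fps_of_poly s) ^ k"
    using c by (simp add: power_mult_distrib fps_const_power mult.assoc del: fps_const_mult)
  then obtain w where w: "of_int_fps G = fps_const w * (fps_const m * fps_of_poly s)"
    using fps_eq_const_mult_of_power_eq k by blast
  have "fps_nth G n = 0" if "n > degree s" for n
  proof -
    have "of_int (fps_nth G n) = (0 :: complex)"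
      using arg_cong[OF w, of "\<lambda>f. fps_nth f n"] that by (simp add: coeff_eq_0)
    then show ?thesis by simp
  qed
  then have "G = fps_of_poly (truncate_fps (Suc (degree s)) G)"
    by (auto simp: fps_eq_iff coeff_truncate_fps)
  then show ?thesis by (rule that)
qed

text \<open>In a relation of least degree, the functional equation produces a second relation of the
  same degree, which must be proportional to the first. Comparing the top coefficient with another
  nonzero one shows that a power of F is rational, and then F itself is.\<close>

lemma fps_transcendental:
  fixes F :: "int fps" and D N :: "int poly"
  assumes F0: "F \<noteq> 0" and D0: "D \<noteq> 0" and N0: "N \<noteq> 0"
    and feq: "fps_of_poly D * F = fps_of_poly N * fps_sq F"
    and irr: "\<And>P Q. fps_of_poly Q * F = fps_of_poly P \<Longrightarrow> Q = 0"
    and rel: "(\<Sum>j\<le>n. fps_of_poly (a j) * F ^ j) = 0" and j: "j \<le> n"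
  shows "a j = 0"
proof (rule ccontr)
  assume "a j \<noteq> 0"
  define Rel where "Rel = (\<lambda>n (a :: nat \<Rightarrow> int poly). (\<Sum>j\<le>n. fps_of_poly (a j) * F ^ j) = 0 \<and> (\<exists>j\<le>n. a j \<noteq> 0))"
  have "Rel n a" using rel j \<open>a j \<noteq> 0\<close> by (auto simp: Rel_def)
  then have ex: "\<exists>n a. Rel n a" by blast
  define n where "n = (LEAST n. \<exists>a. Rel n a)"
  obtain a where "Rel n a" using LeastI_ex[OF ex] n_def by blast
  then have rel: "(\<Sum>j\<le>n. fps_of_poly (a j) * F ^ j) = 0" and a_nz: "\<exists>j\<le>n. a j \<noteq> 0"
    by (auto simp: Rel_def)
  have minimal: "c j = 0" if rel_c: "(\<Sum>j<n. fps_of_poly (c j) * F ^ j) = 0" and jn: "j < n" for c j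
  proof (rule ccontr)
    assume "c j \<noteq> 0"
    obtain m where m: "n = Suc m" using jn by (cases n) auto
    have "Rel m c" using rel_c jn \<open>c j \<noteq> 0\<close> unfolding Rel_def m lessThan_Suc_atMost by (auto simp: less_Suc_eq_le)
    then have "n \<le> m" unfolding n_def by (blast intro: Least_le)
    then show False using m by simp
  qed
  have rel': "(\<Sum>j<n. fps_of_poly (a j) * F ^ j) + fps_of_poly (a n) * F ^ n = 0"
    using rel by (simp add: lessThan_Suc_atMost[symmetric])
  have an: "a n \<noteq> 0"
  proof
    assume "a n = 0"
    then have "\<forall>j<n. a j = 0" using rel' minimal[of a] by simp
    then show False using a_nz \<open>a n = 0\<close> by (auto simp: le_less)
  qed
  \<comment> \<open>A relation consisting of the top term alone would force
    \<open>F = 0\<close>.\<close>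
  obtain i where i: "i < n" "a i \<noteq> 0"
  proof (rule ccontr)
    assume "\<not> thesis"
    then have "\<forall>j<n. a j = 0" using that by blast
    then have "fps_of_poly (a n) * F ^ n = 0" using rel' by simp
    then show False using an F0 by simp
  qed
  define k where "k = n - i"
  have k: "k > 0" "n = i + k" using i by (simp_all add: k_def)
  define a2 where "a2 = (\<lambda>j. pcompose (a j) (monom 1 2))"
  have a2: "fps_of_poly (a2 j) = fps_sq (fps_of_poly (a j))" for j
    by (simp add: a2_def fps_sq_of_poly)
  \<comment> \<open>Substituting z^2 into the relation and multiplying by \<open>N ^ n\<close>
    allows each \<open>(N * fps_sq F) ^ j\<close> to be replaced by \<open>(D * F) ^ j\<close>:
    again a relation for F of degree n.\<close>
  define b where "b = (\<lambda>j. a2 j * N ^ (n - j) * D ^ j)"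
  have b: "fps_of_poly (b j) * F ^ j = fps_of_poly N ^ n * fps_sq (fps_of_poly (a j) * F ^ j)" if "j \<le> n" for j
  proof -
    have "fps_of_poly N ^ n = fps_of_poly N ^ (n - j) * fps_of_poly N ^ j"
      using that by (simp flip: power_add)
    then have "fps_of_poly N ^ n * fps_sq (fps_of_poly (a j) * F ^ j)
        = fps_of_poly (a2 j) * fps_of_poly N ^ (n - j) * (fps_of_poly N * fps_sq F) ^ j"
      by (simp add: fps_sq_mult fps_sq_power a2 power_mult_distrib mult_ac)
    also have "\<dots> = fps_of_poly (b j) * F ^ j"
      unfolding feq[symmetric] by (simp add: b_def fps_of_poly_mult fps_of_poly_power power_mult_distrib mult_ac)
    finally show ?thesis by simp
  qed
  have "(\<Sum>j\<le>n. fps_of_poly (b j) * F ^ j) = fps_of_poly N ^ n * fps_sq (\<Sum>j\<le>n. fps_of_poly (a j) * F ^ j)"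
    by (simp add: b fps_compose_sum_distrib sum_distrib_left)
  then have rel_b: "(\<Sum>j<n. fps_of_poly (b j) * F ^ j) + fps_of_poly (b n) * F ^ n = 0"
    unfolding rel by (simp add: lessThan_Suc_atMost[symmetric])
  define c where "c = (\<lambda>j. a n * b j - b n * a j)"
  have "(\<Sum>j<n. fps_of_poly (c j) * F ^ j) =
      fps_of_poly (a n) * (\<Sum>j<n. fps_of_poly (b j) * F ^ j) - fps_of_poly (b n) * (\<Sum>j<n. fps_of_poly (a j) * F ^ j)"
    by (simp add: c_def fps_of_poly_diff fps_of_poly_mult algebra_simps sum_subtractf sum_distrib_left)
  also have "(\<Sum>j<n. fps_of_poly (b j) * F ^ j) = - (fps_of_poly (b n) * F ^ n)"
    using rel_b by (simp add: eq_neg_iff_add_eq_0)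
  also have "(\<Sum>j<n. fps_of_poly (a j) * F ^ j) = - (fps_of_poly (a n) * F ^ n)"
    using rel' by (simp add: eq_neg_iff_add_eq_0)
  finally have "(\<Sum>j<n. fps_of_poly (c j) * F ^ j) = 0" by simp
  then have "c i = 0" using minimal i by blast
  then have "D ^ i * (a n * a2 i * N ^ k) = D ^ i * (a2 n * D ^ k * a i)"
    by (simp add: c_def b_def k power_add mult_ac)
  then have key: "a n * a2 i * N ^ k = a2 n * D ^ k * a i" using D0 by simp
  \<comment> \<open>The vanishing of \<open>c i\<close> says that U / V is unchanged by z -> z^2,
    hence constant.\<close>
  define U V where "U = fps_of_poly (a n) * F ^ k" and "V = fps_of_poly (a i)"
  have "fps_of_poly N ^ k * (U * fps_sq V) = fps_of_poly (a n * a2 i * N ^ k) * F ^ k"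
    by (simp add: U_def V_def a2 fps_of_poly_mult fps_of_poly_power mult_ac)
  also have "\<dots> = fps_of_poly (a2 n) * fps_of_poly (a i) * (fps_of_poly D * F) ^ k"
    unfolding key by (simp add: fps_of_poly_mult fps_of_poly_power power_mult_distrib mult_ac)
  also have "\<dots> = fps_of_poly N ^ k * (fps_sq U * V)"
    unfolding feq by (simp add: U_def V_def a2 fps_sq_mult fps_sq_power power_mult_distrib mult_ac)
  finally have "U * fps_sq V = fps_sq U * V" using N0 by simp
  moreover have "V \<noteq> 0" using i by (simp add: V_def)
  ultimately obtain e e' where e: "e \<noteq> 0" "fps_const e * U = fps_const e' * V"
    by (rule fps_sq_proportional)
  \<comment> \<open>Multiplying F by \<open>a n\<close> clears the denominator:
    \<open>a n ^ (k - 1) * U\<close> is \<open>G ^ k\<close>, so this power is a polynomial up to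
    constants.\<close>
  define G where "G = fps_of_poly (a n) * F"
  have "fps_const e * G ^ k = fps_of_poly (a n) ^ (k - 1) * (fps_const e * U)"
  proof -
    have "fps_of_poly (a n) ^ k = fps_of_poly (a n) ^ (k - 1) * fps_of_poly (a n)"
      by (rule power_minus_mult[OF k(1), symmetric])
    then show ?thesis by (simp only: G_def U_def power_mult_distrib mult_ac)
  qed
  also have "\<dots> = fps_of_poly (smult e' (a n ^ (k - 1) * a i))"
    unfolding e(2) by (simp add: V_def fps_of_poly_smult fps_of_poly_mult fps_of_poly_power mult_ac)
  finally have pow: "fps_const e * G ^ k = fps_of_poly (smult e' (a n ^ (k - 1) * a i))" .
  have "G \<noteq> 0" using an F0 by (simp add: G_def)
  moreover have "G * fps_of_poly (D * a2 n) = fps_sq G * fps_of_poly (N * a n)"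
  proof -
    have "G * fps_of_poly (D * a2 n) = fps_of_poly (a n) * fps_of_poly (a2 n) * (fps_of_poly D * F)"
      by (simp add: G_def fps_of_poly_mult mult_ac)
    also have "\<dots> = fps_sq G * fps_of_poly (N * a n)"
      unfolding feq by (simp add: G_def fps_of_poly_mult fps_sq_mult a2 mult_ac)
    finally show ?thesis .
  qed
  moreover have "a2 n \<noteq> 0" using a2[of n] an by (metis fps_of_poly_eq_0_iff fps_sq_eq_0_iff)
  ultimately obtain p where "G = fps_of_poly p"
    using fps_is_poly_of_power[OF pow e(1) k(1)] D0 N0 an by (metis mult_eq_0_iff)
  then show False using irr[of "a n" p] an by (simp add: G_def)
qed

section \<open>Liouville's inequality\<close>

lemma algebraic_minimal_relation:
  fixes x :: "'a::field_char_0"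
  assumes "algebraic x"
  obtains d and p :: "nat \<Rightarrow> int" where "d > 0" "p d \<noteq> 0" "(\<Sum>l\<le>d. of_int (p l) * x ^ l) = 0"
    "\<And>(s :: nat \<Rightarrow> int) l. (\<Sum>l<d. of_int (s l) * x ^ l) = 0 \<Longrightarrow> l < d \<Longrightarrow> s l = 0"
proof -
  define Rel where "Rel = (\<lambda>d (s :: nat \<Rightarrow> int). (\<exists>l<d. s l \<noteq> 0) \<and> (\<Sum>l<d. of_int (s l) * x ^ l) = 0)"
  obtain P :: "int poly" where P: "P \<noteq> 0" "poly (map_poly of_int P) x = 0"
    using assms by (rule algebraicE')
  have "(\<Sum>l<Suc (degree P). of_int (coeff P l) * x ^ l) = 0"
    using P(2) by (simp add: poly_altdef coeff_map_poly degree_map_poly lessThan_Suc_atMost)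
  moreover have "coeff P (degree P) \<noteq> 0" using P(1) by simp
  ultimately have "Rel (Suc (degree P)) (coeff P)" unfolding Rel_def by blast
  then have ex: "\<exists>d s. Rel d s" by blast
  define n where "n = (LEAST d. \<exists>s. Rel d s)"
  obtain p where p: "Rel n p" using LeastI_ex[OF ex] n_def by blast
  have least: "\<not> Rel m s" if "m < n" for m s
    using not_less_Least[of m "\<lambda>d. \<exists>s. Rel d s"] that n_def by blast
  have "n \<noteq> 0" using p by (auto simp: Rel_def)
  \<comment> \<open>\<open>n\<close> counts the powers in the shortest dependent list 1, x, ..., so
    the degree is one less.\<close>
  then obtain d where d: "n = Suc d" by (cases n) auto
  have "p d \<noteq> 0"
  proof
    assume "p d = 0"
    then have "Rel d p" using p unfolding Rel_def d by (auto simp: less_Suc_eq)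
    then show False using least d by simp
  qed
  moreover have "d > 0"
  proof (rule ccontr)
    assume "\<not> d > 0"
    then show False using p \<open>p d \<noteq> 0\<close> by (simp add: Rel_def d)
  qed
  moreover have "s l = 0" if "(\<Sum>l<d. of_int (s l) * x ^ l) = 0" "l < d" for s :: "nat \<Rightarrow> int" and l
    using least[of d s] d that by (auto simp: Rel_def)
  moreover have "(\<Sum>l\<le>d. of_int (p l) * x ^ l) = 0" using p by (simp add: Rel_def d lessThan_Suc_atMost)
  ultimately show ?thesis using that by blast
qed

text \<open>The relation need not be monic: each multiplication by x costs one factor
  \<open>p d\<close>, which keeps the coordinates with respect to 1, x, ..., x^(d-1)
  integral.\<close>

lemma algebraic_power_reduction:
  fixes x :: "'a::comm_ring_1" and p :: "nat \<Rightarrow> int"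
  assumes d: "d > 0" and rel: "(\<Sum>l\<le>d. of_int (p l) * x ^ l) = 0"
  shows "\<exists>t :: nat \<Rightarrow> int. of_int (p d ^ i) * x ^ i = (\<Sum>l<d. of_int (t l) * x ^ l)"
proof (induction i)
  case 0
  have "(\<Sum>l<d. of_int (if l = 0 then 1 else 0) * x ^ l) = 1"
    using d by (subst sum.remove[of _ 0]) auto
  then show ?case by (intro exI[of _ "\<lambda>l. if l = 0 then 1 else 0"]) simp
next
  case (Suc i)
  then obtain t where t: "of_int (p d ^ i) * x ^ i = (\<Sum>l<d. of_int (t l) * x ^ l)" by blast
  obtain d' where d': "d = Suc d'" using d by (cases d) auto
  define t' where "t' = (\<lambda>l. (if l = 0 then 0 else p d * t (l - 1)) - t d' * p l)"
  have top: "of_int (p d) * x ^ d = - (\<Sum>l<d. of_int (p l) * x ^ l)"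
    using rel by (simp add: lessThan_Suc_atMost[symmetric] eq_neg_iff_add_eq_0 add.commute)
  have "of_int (p d ^ Suc i) * x ^ Suc i = of_int (p d) * x * (\<Sum>l<d. of_int (t l) * x ^ l)"
    unfolding t[symmetric] by (simp add: mult_ac)
  also have "\<dots> = (\<Sum>l<d. of_int (p d * t l) * x ^ Suc l)"
    by (simp add: sum_distrib_left mult_ac)
  also have "\<dots> = (\<Sum>l<d'. of_int (p d * t l) * x ^ Suc l) + of_int (t d') * (of_int (p d) * x ^ d)"
    by (simp add: d' mult_ac)
  also have "(\<Sum>l<d'. of_int (p d * t l) * x ^ Suc l) = (\<Sum>l<d. of_int (if l = 0 then 0 else p d * t (l - 1)) * x ^ l)"
    unfolding d' sum.lessThan_Suc_shift by simp
  finally have "of_int (p d ^ Suc i) * x ^ Suc i = (\<Sum>l<d. of_int (t' l) * x ^ l)"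
    unfolding top by (simp add: t'_def sum_distrib_left algebra_simps sum_subtractf)
  then show ?case by blast
qed

text \<open>Pigeonhole gives a nonzero combination \<open>s\<close> of \<open>1, x, ..., x ^ (d - 1)\<close> of small height whose product
  with \<open>r\<close> is, up to a constant factor, a nonzero integer; so \<open>r\<close> cannot be too small.\<close>

lemma algebraic_liouville:
  fixes x :: real
  assumes "algebraic x"
  obtains d where "\<forall>N. \<exists>c>0. \<forall>(r :: nat \<Rightarrow> int) H. H \<ge> 1 \<longrightarrow> (\<forall>i\<le>N. \<bar>r i\<bar> \<le> H) \<longrightarrow>
      (\<Sum>i\<le>N. of_int (r i) * x ^ i) \<noteq> 0 \<longrightarrow> c / of_int H ^ d \<le> \<bar>\<Sum>i\<le>N. of_int (r i) * x ^ i\<bar>"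
proof -
  obtain d and p :: "nat \<Rightarrow> int" where d: "d > 0" and pd: "p d \<noteq> 0"
    and rel: "(\<Sum>l\<le>d. of_int (p l) * x ^ l) = 0"
    and minimal: "\<And>(s :: nat \<Rightarrow> int) l. (\<Sum>l<d. of_int (s l) * x ^ l) = 0 \<Longrightarrow> l < d \<Longrightarrow> s l = 0"
    using assms by (rule algebraic_minimal_relation) metis
  obtain t :: "nat \<Rightarrow> nat \<Rightarrow> int" where t: "of_int (p d ^ i) * x ^ i = (\<Sum>l<d. of_int (t i l) * x ^ l)" for i
    using algebraic_power_reduction[OF d rel] by metis
  show ?thesis
  proof (rule that[of "d - 1"], rule allI)
    fix N
    \<comment> \<open>The product of the two combinations involves powers of x up to
      \<open>N + d - 1\<close>, so \<open>p d ^ K\<close> makes all coordinates integral.\<close>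
    define K where "K = N + d"
    define T where "T = 1 + (\<Sum>i\<le>K. \<Sum>j<d. \<bar>p d ^ (K - i) * t i j\<bar>)"
    have T: "\<bar>p d ^ (K - i) * t i j\<bar> \<le> T" if "i \<le> K" "j < d" for i j
    proof -
      have "\<bar>p d ^ (K - i) * t i j\<bar> \<le> (\<Sum>j<d. \<bar>p d ^ (K - i) * t i j\<bar>)"
        using that by (intro member_le_sum) auto
      also have "\<dots> \<le> (\<Sum>i\<le>K. \<Sum>j<d. \<bar>p d ^ (K - i) * t i j\<bar>)"
        using that by (intro member_le_sum[of _ _ "\<lambda>i. \<Sum>j<d. \<bar>p d ^ (K - i) * t i j\<bar>"]) (auto intro: sum_nonneg)
      finally show ?thesis by (simp add: T_def)
    qed
    have T1: "T \<ge> 1" by (simp add: T_def sum_nonneg)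
    define E where "E = int d * (int N + 1) * T"
    have E1: "E \<ge> 1"
    proof -
      have "1 \<le> int d * (int N + 1)" using d mult_mono[of 1 "int d" 1 "int N + 1"] by simp
      then show ?thesis unfolding E_def using T1 mult_mono[of 1 "int d * (int N + 1)" 1 T] by simp
    qed
    define c :: real where "c = 1 / (\<bar>of_int (p d ^ K)\<bar> * (\<Sum>l<d. \<bar>x\<bar> ^ l) * of_int (3 * E) ^ (d - 1))"
    have sum_pos: "(\<Sum>l<d. \<bar>x\<bar> ^ l) > 0"
    proof -
      have "(1::real) \<le> (\<Sum>l<d. \<bar>x\<bar> ^ l)"
        using d member_le_sum[of 0 "{..<d}" "\<lambda>l. \<bar>x\<bar> ^ l"] by simp
      then show ?thesis by linarith
    qed
    have c0: "c > 0" using pd sum_pos E1 by (simp add: c_def)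
    have "c / of_int H ^ (d - 1) \<le> \<bar>\<Sum>i\<le>N. of_int (r i) * x ^ i\<bar>"
      if H: "H \<ge> 1" and r: "\<forall>i\<le>N. \<bar>r i\<bar> \<le> H" and nz: "(\<Sum>i\<le>N. of_int (r i) * x ^ i) \<noteq> 0"
      for r :: "nat \<Rightarrow> int" and H
    proof -
      \<comment> \<open>\<open>\<Phi> s j\<close> is the j-th coordinate of \<open>p d ^ K\<close>
        times the product of the combinations \<open>s\<close> and \<open>r\<close>.\<close>
      define \<Phi> where "\<Phi> = (\<lambda>(s :: nat \<Rightarrow> int) j. \<Sum>l<d. \<Sum>i\<le>N. s l * r i * (p d ^ (K - (l + i)) * t (l + i) j))"
      have \<Phi>_bound: "\<bar>\<Phi> s j\<bar> \<le> E * (B * H)" if "\<And>l. l < d \<Longrightarrow> \<bar>s l\<bar> \<le> B" "j < d" for s B j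
      proof -
        have "\<bar>\<Phi> s j\<bar> \<le> (\<Sum>l<d. \<Sum>i\<le>N. \<bar>s l * r i * (p d ^ (K - (l + i)) * t (l + i) j)\<bar>)"
          unfolding \<Phi>_def by (intro order_trans[OF sum_abs] sum_mono) auto
        also have "\<dots> \<le> (\<Sum>l<d. \<Sum>i\<le>N. B * H * T)"
        proof (intro sum_mono)
          fix l i assume li: "l \<in> {..<d}" "i \<in> {..N}"
          have "\<bar>s l\<bar> \<le> B" "\<bar>r i\<bar> \<le> H" "\<bar>p d ^ (K - (l + i)) * t (l + i) j\<bar> \<le> T"
            using that li r T[of "l + i" j] by (auto simp: K_def)
          then show "\<bar>s l * r i * (p d ^ (K - (l + i)) * t (l + i) j)\<bar> \<le> B * H * T"
            unfolding abs_mult[of "s l * r i"] abs_mult[of "s l"] using H by (intro mult_mono) auto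
        qed
        also have "\<dots> = E * (B * H)" by (simp add: E_def mult_ac)
        finally show ?thesis .
      qed
      have \<Phi>_eval: "of_int (p d ^ K) * ((\<Sum>l<d. of_int (s l) * x ^ l) * (\<Sum>i\<le>N. of_int (r i) * x ^ i))
          = (\<Sum>j<d. of_int (\<Phi> s j) * x ^ j)" for s
      proof -
        have pow: "of_int (p d ^ K) * x ^ m = (\<Sum>j<d. of_int (p d ^ (K - m) * t m j) * x ^ j)" if "m \<le> K" for m
        proof -
          have "of_int (p d ^ K) * x ^ m = of_int (p d ^ (K - m)) * (of_int (p d ^ m) * x ^ m)"
            using that by (simp flip: power_add mult.assoc)
          then show ?thesis unfolding t by (simp add: sum_distrib_left mult_ac)
        qed
        have "of_int (p d ^ K) * ((\<Sum>l<d. of_int (s l) * x ^ l) * (\<Sum>i\<le>N. of_int (r i) * x ^ i))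
            = (\<Sum>l<d. \<Sum>i\<le>N. of_int (s l * r i) * (of_int (p d ^ K) * x ^ (l + i)))"
          by (simp add: sum_product sum_distrib_left power_add mult_ac)
        also have "\<dots> = (\<Sum>l<d. \<Sum>i\<le>N. of_int (s l * r i) *
            (\<Sum>j<d. of_int (p d ^ (K - (l + i)) * t (l + i) j) * x ^ j))"
          by (intro sum.cong refl arg_cong2[where f = "(*)"] pow) (auto simp: K_def)
        also have "\<dots> = (\<Sum>l<d. \<Sum>i\<le>N. \<Sum>j<d.
            of_int (s l * r i * (p d ^ (K - (l + i)) * t (l + i) j)) * x ^ j)"
          by (simp add: sum_distrib_left mult_ac)
        also have "\<dots> = (\<Sum>l<d. \<Sum>j<d. \<Sum>i\<le>N.
            of_int (s l * r i * (p d ^ (K - (l + i)) * t (l + i) j)) * x ^ j)"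
          by (intro sum.cong refl sum.swap)
        also have "\<dots> = (\<Sum>j<d. \<Sum>l<d. \<Sum>i\<le>N.
            of_int (s l * r i * (p d ^ (K - (l + i)) * t (l + i) j)) * x ^ j)"
          by (rule sum.swap)
        also have "\<dots> = (\<Sum>j<d. of_int (\<Phi> s j) * x ^ j)"
          unfolding \<Phi>_def of_int_sum sum_distrib_right ..
        finally show ?thesis .
      qed
      \<comment> \<open>Balances the pigeonhole count: there are at most
        \<open>(3 E H B) ^ (d - 1) = B ^ d\<close> value vectors for \<open>(B + 1) ^ d\<close>
        choices of \<open>s\<close>.\<close>
      define B where "B = (3 * E * H) ^ (d - 1)"
      have EH: "E * H \<ge> 1" using E1 H mult_mono[of 1 E 1 H] by simp
      have B1: "B \<ge> 1" unfolding B_def using EH by (intro one_le_power) (simp add: mult.assoc)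
      define A where "A = PiE {..<d} (\<lambda>_. {0..B})"
      define W where "W = PiE {1..<d} (\<lambda>_. {- (E * (B * H))..E * (B * H)})"
      have cardA: "card A = nat (B + 1) ^ d"
        unfolding A_def using B1 by (simp add: card_PiE)
      have cardW: "card W = nat (2 * (E * (B * H)) + 1) ^ (d - 1)"
        unfolding W_def by (simp add: card_PiE mult_ac)
      have EBH: "E * (B * H) \<ge> 1" using EH B1 mult_mono[of 1 "E * H" 1 B] by (simp add: mult_ac)
      have "nat (2 * (E * (B * H)) + 1) ^ (d - 1) \<le> nat (3 * E * H * B) ^ (d - 1)"
        using EBH by (intro power_mono nat_mono) (auto simp: mult_ac)
      also have "\<dots> = nat B * nat B ^ (d - 1)"
        using EH B1 E1 H by (simp add: nat_mult_distrib power_mult_distrib B_def nat_power_eq mult.assoc)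
      also have "\<dots> = nat B ^ d" using d by (cases d) auto
      also have "\<dots> < nat (B + 1) ^ d" using d B1 by (intro power_strict_mono) auto
      finally have less: "card W < card A" unfolding cardA cardW .
      \<comment> \<open>Coordinate 0 is left out on purpose. Matching the others makes the product
        attached to the difference equal to its coordinate 0, an integer.\<close>
      define f where "f = (\<lambda>s. restrict (\<Phi> s) {1..<d})"
      have "f ` A \<subseteq> W"
      proof safe
        fix s assume s: "s \<in> A"
        have "\<bar>\<Phi> s j\<bar> \<le> E * (B * H)" if "j < d" for j
          using s that by (intro \<Phi>_bound) (auto simp: A_def PiE_def Pi_def)
        then show "f s \<in> W" by (force simp: f_def W_def abs_le_iff)
      qed
      moreover have "finite W" by (simp add: W_def finite_PiE)
      ultimately have "\<not> inj_on f A"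
        using less card_inj_on_le[of f A W] by linarith
      then obtain s s' where ss: "s \<in> A" "s' \<in> A" "s \<noteq> s'" "f s = f s'"
        by (auto simp: inj_on_def)
      define u where "u = (\<lambda>l. s l - s' l)"
      have u_bound: "\<bar>u l\<bar> \<le> B" if "l < d" for l
      proof -
        have "s l \<in> {0..B}" "s' l \<in> {0..B}" using ss that by (auto simp: A_def PiE_def Pi_def)
        then show ?thesis by (auto simp: u_def)
      qed
      have u_nz: "\<exists>l<d. u l \<noteq> 0"
      proof (rule ccontr)
        assume "\<not> (\<exists>l<d. u l \<noteq> 0)"
        then have "s = s'" using ss(1,2) unfolding A_def by (intro PiE_ext[of s _ _ s']) (auto simp: u_def)
        then show False using ss by simp
      qed
      have "\<Phi> u j = \<Phi> s j - \<Phi> s' j" for j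
        by (simp add: \<Phi>_def u_def left_diff_distrib sum_subtractf)
      moreover have "\<Phi> s j = \<Phi> s' j" if "j \<in> {1..<d}" for j
        using fun_cong[OF ss(4), of j] that by (simp add: f_def)
      ultimately have \<Phi>0: "\<Phi> u j = 0" if "j \<in> {1..<d}" for j using that by simp
      have "(\<Sum>j<d. of_int (\<Phi> u j) * x ^ j) = (\<Sum>j\<in>{0}. of_int (\<Phi> u j) * x ^ j)"
        using d \<Phi>0 by (intro sum.mono_neutral_right) auto
      then have int: "of_int (p d ^ K) * ((\<Sum>l<d. of_int (u l) * x ^ l) * (\<Sum>i\<le>N. of_int (r i) * x ^ i))
          = of_int (\<Phi> u 0)"
        using \<Phi>_eval[of u] by simp
      have "(\<Sum>l<d. of_int (u l) * x ^ l) \<noteq> 0" using minimal u_nz by blast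
      then have "\<Phi> u 0 \<noteq> 0" using int nz pd by auto
      then have "1 \<le> \<bar>of_int (\<Phi> u 0) :: real\<bar>" by linarith
      also have "\<dots> = \<bar>of_int (p d ^ K)\<bar> * (\<bar>\<Sum>l<d. of_int (u l) * x ^ l\<bar> * \<bar>\<Sum>i\<le>N. of_int (r i) * x ^ i\<bar>)"
        unfolding int[symmetric] by (simp add: abs_mult)
      also have "\<dots> \<le> \<bar>of_int (p d ^ K)\<bar> * ((of_int B * (\<Sum>l<d. \<bar>x\<bar> ^ l)) * \<bar>\<Sum>i\<le>N. of_int (r i) * x ^ i\<bar>)"
      proof (intro mult_left_mono mult_right_mono)
        have "\<bar>\<Sum>l<d. of_int (u l) * x ^ l\<bar> \<le> (\<Sum>l<d. \<bar>of_int (u l) * x ^ l\<bar>)" by (rule sum_abs)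
        also have "\<dots> \<le> (\<Sum>l<d. of_int B * \<bar>x\<bar> ^ l)"
        proof (intro sum_mono)
          fix l assume "l \<in> {..<d}"
          then have "\<bar>of_int (u l) :: real\<bar> \<le> of_int B" using u_bound[of l] by (simp flip: of_int_abs)
          then show "\<bar>of_int (u l) * x ^ l\<bar> \<le> of_int B * \<bar>x\<bar> ^ l"
            by (simp add: abs_mult power_abs mult_right_mono)
        qed
        finally show "\<bar>\<Sum>l<d. of_int (u l) * x ^ l\<bar> \<le> of_int B * (\<Sum>l<d. \<bar>x\<bar> ^ l)"
          by (simp add: sum_distrib_left)
      qed auto
      also have "\<dots> = \<bar>\<Sum>i\<le>N. of_int (r i) * x ^ i\<bar> * (of_int H ^ (d - 1) / c)"
        by (simp add: B_def c_def power_mult_distrib mult_ac)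
      finally have "1 \<le> \<bar>\<Sum>i\<le>N. of_int (r i) * x ^ i\<bar> * (of_int H ^ (d - 1) / c)" .
      moreover have "of_int H ^ (d - 1) > (0 :: real)" using H by simp
      ultimately show ?thesis using c0 by (simp add: field_simps)
    qed
    then show "\<exists>c>0. \<forall>(r :: nat \<Rightarrow> int) H. H \<ge> 1 \<longrightarrow> (\<forall>i\<le>N. \<bar>r i\<bar> \<le> H) \<longrightarrow>
      (\<Sum>i\<le>N. of_int (r i) * x ^ i) \<noteq> 0 \<longrightarrow> c / of_int H ^ (d - 1) \<le> \<bar>\<Sum>i\<le>N. of_int (r i) * x ^ i\<bar>"
      using c0 by blast
  qed
qed

section \<open>Irrationality exponents\<close>

text \<open>Each p / q is compared with one auxiliary approximation whose error is just below 1 / (2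
  q). Since \<open>\<gamma>\<close> is the same for all \<open>a\<close>, its height exceeds q by at
  most a factor of order \<open>X m ^ (\<gamma> + 1)\<close>, and choosing \<open>a > N\<close>
  makes this factor at most q to the power \<open>\<eta>\<close>, up to constants.\<close>

lemma rational_approximation_lower_bound:
  fixes xi b :: real and \<gamma> N :: nat
  assumes b: "b \<ge> 2" and N: "N > 0"
    and approx: "\<And>a. \<exists>K>0. \<exists>m0. \<forall>m\<ge>m0. \<exists>p q::int.
        \<bar>of_int q\<bar> \<le> K * (b ^ 2 ^ m) ^ (a + \<gamma>) \<and>
        \<bar>of_int q * xi - of_int p\<bar> \<le> K / (b ^ 2 ^ m) ^ a \<and>
        1 / (K * (b ^ 2 ^ m) ^ (a + \<gamma>)) \<le> \<bar>of_int q * xi - of_int p\<bar>"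
  defines "\<eta> \<equiv> (real \<gamma> + 1) / real N"
  obtains c q0 :: real where "c > 0"
    "\<And>p q::int. of_int q \<ge> q0 \<Longrightarrow> q > 0 \<Longrightarrow> c * of_int q powr (- (2 + 2 * \<eta>)) \<le> \<bar>xi - of_int p / of_int q\<bar>"
proof -
  define X where "X = (\<lambda>m::nat. b ^ 2 ^ m)"
  have X1: "X m \<ge> 1" for m using b by (simp add: X_def)
  have X_Suc: "X (Suc m) = X m ^ 2" for m by (simp add: X_def power_mult[symmetric] mult.commute)
  have X_mono: "X m \<le> X n" if "m \<le> n" for m n
    unfolding X_def using b that by (intro power_increasing) auto
  have X_ge: "real m \<le> X m" for m
  proof -
    have "real m \<le> real (2 ^ 2 ^ m)" using less_exp[of m] less_exp[of "2 ^ m"] by (intro of_nat_mono) linarith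
    also have "\<dots> = 2 ^ 2 ^ m" by simp
    also have "\<dots> \<le> X m" unfolding X_def using b by (intro power_mono) auto
    finally show ?thesis .
  qed
  obtain K0 m0 where K0: "K0 a > 0" and appr: "\<And>m. m \<ge> m0 a \<Longrightarrow> \<exists>p q::int.
        \<bar>of_int q\<bar> \<le> K0 a * X m ^ (a + \<gamma>) \<and>
        \<bar>of_int q * xi - of_int p\<bar> \<le> K0 a / X m ^ a \<and>
        1 / (K0 a * X m ^ (a + \<gamma>)) \<le> \<bar>of_int q * xi - of_int p\<bar>" for a
    using approx unfolding X_def by metis
  \<comment> \<open>Only exponents \<open>a\<close> up to \<open>2 * N\<close> will occur, so one
    constant and one threshold serve for all.\<close>
  define K where "K = 1 + (\<Sum>a\<le>2*N. K0 a)"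
  define M where "M = (\<Sum>a\<le>2*N. m0 a)"
  have K_ge: "K0 a \<le> K" if "a \<le> 2 * N" for a
  proof -
    have "K0 a \<le> (\<Sum>a\<le>2*N. K0 a)" using that K0 by (intro member_le_sum) (auto intro: less_imp_le)
    then show ?thesis by (simp add: K_def)
  qed
  have M_ge: "m0 a \<le> M" if "a \<le> 2 * N" for a
    unfolding M_def using that by (intro member_le_sum) auto
  have K1: "K \<ge> 1" unfolding K_def using K0 by (simp add: sum_nonneg less_imp_le)
  define c where "c = 1 / (K ^ 2 * (2 * K) powr (2 + 2 * \<eta>))"
  have \<eta>0: "\<eta> \<ge> 0" by (simp add: \<eta>_def)
  show ?thesis
  proof (rule that[of c "X M ^ N"])
    show "c > 0" using K1 by (simp add: c_def)
    fix p q :: int assume q: "of_int q \<ge> X M ^ N" "q > 0"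
    \<comment> \<open>Chosen so that an error below \<open>K / Z\<close> is below 1 / (2 q), leaving
      half of the determinant used below.\<close>
    define Z where "Z = 2 * K * of_int q"
    have qZ: "of_int q \<le> Z" using K1 q(2) mult_mono[of 1 "2 * K" "of_int q" "of_int q"] by (simp add: Z_def)
    have Z1: "Z \<ge> 1" using qZ q(2) by linarith
    have "\<exists>m. Z < X m ^ N"
    proof -
      obtain m where "Z < real m" using reals_Archimedean2 by blast
      also have "real m \<le> X m" by (rule X_ge)
      also have "X m \<le> X m ^ N" using X1[of m] N by (simp add: self_le_power)
      finally show ?thesis by blast
    qed
    \<comment> \<open>As \<open>X (Suc m) = X m ^ 2\<close>, the predecessor \<open>m\<close> of
      \<open>m'\<close> satisfies \<open>X m ^ N \<le> Z < X m ^ (2 * N)\<close>; the least exponent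
      \<open>a\<close> with \<open>Z < X m ^ a\<close> thus lies between \<open>N + 1\<close> and
      \<open>2 * N\<close>.\<close>
    define m' where "m' = (LEAST m. Z < X m ^ N)"
    have m': "Z < X m' ^ N" unfolding m'_def using \<open>\<exists>m. Z < X m ^ N\<close> by (rule LeastI_ex)
    have "M < m'"
    proof (rule ccontr)
      assume "\<not> M < m'"
      then have "X m' ^ N \<le> X M ^ N" using X_mono X1[of m'] by (intro power_mono) auto
      then show False using m' q qZ by linarith
    qed
    then obtain m where m: "m' = Suc m" "M \<le> m" by (cases m') auto
    have XN: "X m ^ N \<le> Z"
      using not_less_Least[of m "\<lambda>m. Z < X m ^ N"] m unfolding m'_def by auto
    have X2N: "Z < X m ^ (2 * N)" using m' unfolding m X_Suc by (simp add: power_mult[symmetric])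
    define a where "a = (LEAST a. Z < X m ^ a)"
    have a: "Z < X m ^ a" unfolding a_def using X2N by (rule LeastI)
    have a_le: "a \<le> 2 * N" unfolding a_def using X2N by (rule Least_le)
    have "N < a"
    proof (rule ccontr)
      assume "\<not> N < a"
      then have "X m ^ a \<le> X m ^ N" using X1[of m] by (intro power_increasing) auto
      then show False using a XN by linarith
    qed
    then obtain a' where a': "a = Suc a'" by (cases a) auto
    have Xa': "X m ^ a' \<le> Z"
      using not_less_Least[of a' "\<lambda>a. Z < X m ^ a"] a' unfolding a_def by auto
    define Y where "Y = X m ^ (a + \<gamma>)"
    have Y1: "Y \<ge> 1" unfolding Y_def using X1 by (rule one_le_power)
    \<comment> \<open>Minimality of \<open>a\<close> bounds \<open>X m ^ (a - 1)\<close> by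
      \<open>Z\<close>; each of the other \<open>\<gamma> + 1\<close> factors is at most the N-th
      root of \<open>Z\<close>.\<close>
    have Y_le: "Y \<le> Z powr (1 + \<eta>)"
    proof -
      have "X m = (X m ^ N) powr (1 / N)"
        using X1[of m] N by (simp add: powr_powr flip: powr_realpow)
      also have "\<dots> \<le> Z powr (1 / N)" using XN X1[of m] by (intro powr_mono2) auto
      finally have "X m ^ Suc \<gamma> \<le> (Z powr (1 / N)) ^ Suc \<gamma>" using X1[of m] by (intro power_mono) auto
      also have "\<dots> = Z powr \<eta>"
        using Z1 by (simp add: \<eta>_def powr_powr flip: powr_realpow) (simp add: powr_add[symmetric] add_divide_distrib add.commute)
      finally have "X m ^ a' * X m ^ Suc \<gamma> \<le> Z * Z powr \<eta>"
        using Xa' X1[of m] Z1 by (intro mult_mono) auto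
      moreover have "Y = X m ^ a' * X m ^ Suc \<gamma>" by (simp add: Y_def a' power_add)
      moreover have "Z * Z powr \<eta> = Z powr (1 + \<eta>)" using Z1 by (simp add: powr_add)
      ultimately show ?thesis by simp
    qed
    obtain p' q' :: int where pq0: "\<bar>of_int q'\<bar> \<le> K0 a * Y" "\<bar>of_int q' * xi - of_int p'\<bar> \<le> K0 a / X m ^ a"
      "1 / (K0 a * Y) \<le> \<bar>of_int q' * xi - of_int p'\<bar>"
      using appr[of a m] M_ge[OF a_le] m(2) unfolding Y_def by auto
    have Xa0: "X m ^ a > 0" using X1[of m] by simp
    have 1: "\<bar>of_int q'\<bar> \<le> K * Y"
      using pq0(1) K_ge[OF a_le] Y1 by (meson mult_right_mono order_trans zero_le_one)
    have 2: "\<bar>of_int q' * xi - of_int p'\<bar> < 1 / (2 * of_int q)"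
    proof -
      have "K0 a / X m ^ a \<le> K / X m ^ a" using K_ge[OF a_le] Xa0 by (simp add: divide_right_mono)
      also have "\<dots> < K / Z" using a Z1 K1 by (intro divide_strict_left_mono) auto
      also have "\<dots> = 1 / (2 * of_int q)" using K1 by (simp add: Z_def)
      finally show ?thesis using pq0(2) by linarith
    qed
    have 3: "1 / (K * Y) \<le> \<bar>of_int q' * xi - of_int p'\<bar>"
    proof -
      have "1 / (K * Y) \<le> 1 / (K0 a * Y)"
        using K_ge[OF a_le] K0[of a] Y1 by (intro divide_left_mono) (auto intro: mult_right_mono)
      then show ?thesis using pq0(3) by linarith
    qed
    let ?e = "\<bar>of_int q * xi - of_int p\<bar>"
    have qr: "(of_int q :: real) > 0" using q(2) by simp
    \<comment> \<open>If the determinant of the two fractions is nonzero it is at least 1, and the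
      auxiliary error accounts for at most half of it. If it is zero, the lower bound on the
      auxiliary error carries over to p / q.\<close>
    have lower: "1 / (K ^ 2 * Y ^ 2) \<le> ?e / of_int q \<or> 1 / (Z * Y) \<le> ?e / of_int q"
    proof (cases "p * q' = p' * q")
      case True
      then have eq: "of_int p * of_int q' = (of_int p' * of_int q :: real)"
        by (metis of_int_mult)
      have "of_int q * \<bar>of_int q' * xi - of_int p'\<bar> = \<bar>of_int q * (of_int q' * xi - of_int p')\<bar>"
        using qr by (simp add: abs_mult)
      also have "of_int q * (of_int q' * xi - of_int p') = of_int q' * (of_int q * xi - of_int p)"
        using eq by (simp add: algebra_simps)
      also have "\<bar>\<dots>\<bar> = \<bar>of_int q'\<bar> * ?e" by (simp add: abs_mult)
      also have "\<dots> \<le> K * Y * ?e" using 1 by (intro mult_right_mono) auto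
      finally have "of_int q * \<bar>of_int q' * xi - of_int p'\<bar> \<le> K * Y * ?e" .
      moreover have "of_int q * (1 / (K * Y)) \<le> of_int q * \<bar>of_int q' * xi - of_int p'\<bar>"
        using 3 qr by (intro mult_left_mono) auto
      ultimately have "of_int q * (1 / (K * Y)) \<le> K * Y * ?e" by linarith
      then have "1 / (K ^ 2 * Y ^ 2) \<le> ?e / of_int q"
        using K1 Y1 qr by (simp add: field_simps power2_eq_square)
      then show ?thesis ..
    next
      case False
      have "1 \<le> \<bar>p * q' - p' * q\<bar>" using False by linarith
      then have "1 \<le> \<bar>of_int (p * q' - p' * q) :: real\<bar>" by linarith
      also have "of_int (p * q' - p' * q) = of_int q * (of_int q' * xi - of_int p') - of_int q' * (of_int q * xi - of_int p)"
        by (simp add: algebra_simps)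
      also have "\<bar>\<dots>\<bar> \<le> of_int q * \<bar>of_int q' * xi - of_int p'\<bar> + \<bar>of_int q'\<bar> * ?e"
        using qr by (intro order_trans[OF abs_triangle_ineq4]) (simp add: abs_mult)
      also have "of_int q * \<bar>of_int q' * xi - of_int p'\<bar> \<le> of_int q * (1 / (2 * of_int q))"
        using 2 qr by (intro mult_left_mono) auto
      also have "\<dots> = 1 / 2" using qr by simp
      also have "\<bar>of_int q'\<bar> * ?e \<le> K * Y * ?e" using 1 by (intro mult_right_mono) auto
      finally have "1 \<le> 2 * K * Y * ?e" by simp
      then have "1 / (Z * Y) \<le> ?e / of_int q"
        using K1 Y1 qr by (simp add: field_simps Z_def)
      then show ?thesis ..
    qed
    have "Z powr (1 + \<eta>) * Z powr (1 + \<eta>) = Z powr (2 + 2 * \<eta>)"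
      by (simp add: powr_add[symmetric])
    then have Y2: "Y ^ 2 \<le> Z powr (2 + 2 * \<eta>)"
      using Y_le Y1 mult_mono[OF Y_le Y_le] by (simp add: power2_eq_square)
    have Z_le: "Z \<le> Z powr (1 + \<eta>)" using Z1 \<eta>0 powr_mono[of 1 "1 + \<eta>" Z] by simp
    have ZY: "Z * Y \<le> Z powr (2 + 2 * \<eta>)"
      using mult_mono[OF Z_le Y_le] Z1 Y1 \<open>Z powr (1 + \<eta>) * Z powr (1 + \<eta>) = _\<close> by simp
    have K2: "1 \<le> K ^ 2" using K1 by simp
    have "1 / (K ^ 2 * Z powr (2 + 2 * \<eta>)) \<le> ?e / of_int q"
      using lower
    proof
      assume "1 / (K ^ 2 * Y ^ 2) \<le> ?e / of_int q"
      moreover have "1 / (K ^ 2 * Z powr (2 + 2 * \<eta>)) \<le> 1 / (K ^ 2 * Y ^ 2)"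
        using Y2 Y1 K1 Z1 by (intro divide_left_mono mult_left_mono) auto
      ultimately show ?thesis by linarith
    next
      assume "1 / (Z * Y) \<le> ?e / of_int q"
      moreover have "Z * Y \<le> K ^ 2 * Z powr (2 + 2 * \<eta>)"
        using ZY K2 mult_mono[of 1 "K ^ 2" "Z * Y" "Z powr (2 + 2 * \<eta>)"] Z1 Y1 by simp
      then have "1 / (K ^ 2 * Z powr (2 + 2 * \<eta>)) \<le> 1 / (Z * Y)"
        using Y1 K1 Z1 by (intro divide_left_mono) auto
      ultimately show ?thesis by linarith
    qed
    moreover have "c * of_int q powr (- (2 + 2 * \<eta>)) = 1 / (K ^ 2 * Z powr (2 + 2 * \<eta>))"
    proof -
      have "Z powr e = (2 * K) powr e * of_int q powr e" for e
        unfolding Z_def using K1 qr by (simp add: powr_mult)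
      then show ?thesis unfolding c_def powr_minus_divide by simp
    qed
    moreover have "\<bar>xi - of_int p / of_int q\<bar> = ?e / of_int q"
    proof -
      have "xi - of_int p / of_int q = (of_int q * xi - of_int p) / of_int q"
        using qr by (simp add: field_simps)
      then show ?thesis using qr by simp
    qed
    ultimately show "c * of_int q powr (- (2 + 2 * \<eta>)) \<le> \<bar>xi - of_int p / of_int q\<bar>" by simp
  qed
qed

text \<open>Dirichlet's theorem, carried over from coprime pairs to rationals, whose
  \<open>quotient_of\<close> is the reduced pair.\<close>

lemma infinite_quadratic_approximations:
  fixes xi :: real
  assumes "xi \<notin> \<rat>"
  shows "infinite {r::rat. \<bar>xi - of_rat r\<bar> < real_of_int (snd (quotient_of r)) powr (- 2)}"
proof
  let ?S = "{r::rat. \<bar>xi - of_rat r\<bar> < real_of_int (snd (quotient_of r)) powr (- 2)}"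
  assume fin: "finite ?S"
  have "approx_set xi \<subseteq> quotient_of ` ?S"
  proof
    fix hk assume "hk \<in> approx_set xi"
    then obtain h k where hk: "hk = (h, k)" "k > 0" "coprime h k" "\<bar>xi - of_int h / of_int k\<bar> < 1 / (of_int k)\<^sup>2"
      by (auto simp: approx_set_def)
    have quot: "quotient_of (Rat.Fract h k) = (h, k)"
      using hk by (simp add: quotient_of_Fract normalize_def coprime_iff_gcd_eq_1)
    have "of_rat (Rat.Fract h k) = (of_int h / of_int k :: real)"
      using hk by (simp add: of_rat_rat)
    moreover have "real_of_int k powr (- 2) = 1 / (of_int k)\<^sup>2"
      using hk by (simp add: powr_minus field_simps)
    ultimately have "Rat.Fract h k \<in> ?S" using hk quot by simp
    then show "hk \<in> quotient_of ` ?S" using quot hk(1) by (metis image_eqI)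
  qed
  then have "finite (approx_set xi)" using fin finite_surj by blast
  then show False using assms rational_iff_finite_approx_set by blast
qed

lemma irrationality_exponent_eq_2I:
  fixes xi :: real
  assumes irr: "xi \<notin> \<rat>"
    and bound: "\<And>e. e > 0 \<Longrightarrow> \<exists>c q0 :: real. c > 0 \<and> (\<forall>p q::int. of_int q \<ge> q0 \<longrightarrow> q > 0 \<longrightarrow>
      c * of_int q powr (- (2 + e)) \<le> \<bar>xi - of_int p / of_int q\<bar>)"
  shows "irrationality_exponent xi = 2"
proof -
  define S where "S = (\<lambda>mu::real. {r::rat. \<bar>xi - of_rat r\<bar> < real_of_int (snd (quotient_of r)) powr (- mu)})"
  have "finite (S mu)" if mu: "mu > 2" for mu
  proof -
    \<comment> \<open>Half of the excess over 2 goes into the assumed bound; the other half beats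
      the constant \<open>c\<close> and so bounds the denominators.\<close>
    define e where "e = (mu - 2) / 2"
    have e: "e > 0" "mu = 2 + e + e" using mu by (simp_all add: e_def field_simps)
    obtain c q0 :: real where c: "c > 0" and lower: "\<And>p q::int. of_int q \<ge> q0 \<Longrightarrow> q > 0 \<Longrightarrow>
        c * of_int q powr (- (2 + e)) \<le> \<bar>xi - of_int p / of_int q\<bar>"
      using bound[OF e(1)] by auto
    define Q where "Q = \<lceil>max q0 ((1 / c) powr (1 / e))\<rceil>"
    define P where "P = \<lceil>of_int Q * (\<bar>xi\<bar> + 1)\<rceil>"
    have "S mu \<subseteq> (\<lambda>(p, q). Rat.Fract p q) ` ({-P..P} \<times> {0..Q})"
    proof
      fix r assume r: "r \<in> S mu"
      obtain p q where pq: "quotient_of r = (p, q)" by force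
      have q0: "q > 0" using pq by (rule quotient_of_denom_pos)
      have r_eq: "r = Rat.Fract p q" using pq by (simp add: quotient_of_div Fract_of_int_quotient)
      have r_real: "of_rat r = (of_int p / of_int q :: real)" using q0 by (simp add: r_eq of_rat_rat)
      have less: "\<bar>xi - of_int p / of_int q\<bar> < of_int q powr (- mu)"
        using r pq by (simp add: S_def r_real)
      have qQ: "q \<le> Q"
      proof (cases "of_int q \<ge> q0")
        case True
        have "c * of_int q powr (- (2 + e)) < of_int q powr (- (2 + e)) * of_int q powr (- e)"
          using lower[OF True q0, of p] less by (simp add: e(2) flip: powr_add)
        then have "c < of_int q powr (- e)" using q0 by (simp add: mult.commute)
        then have "of_int q powr e < 1 / c" using c q0 by (simp add: powr_minus field_simps)
        then have "(of_int q powr e) powr (1 / e) \<le> (1 / c) powr (1 / e)"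
          using e by (intro powr_mono2) auto
        then have "of_int q \<le> (1 / c) powr (1 / e)" using e q0 by (simp add: powr_powr)
        then show ?thesis unfolding Q_def by linarith
      next
        case False
        then show ?thesis unfolding Q_def by linarith
      qed
      have "of_int q powr (- mu) \<le> 1" using q0 mu powr_mono[of "- mu" 0 "of_int q"] by simp
      then have "\<bar>of_int p / of_int q\<bar> \<le> \<bar>xi\<bar> + 1" using less by linarith
      then have "\<bar>of_int p\<bar> \<le> of_int q * (\<bar>xi\<bar> + 1)" using q0 by (simp add: field_simps)
      also have "\<dots> \<le> of_int Q * (\<bar>xi\<bar> + 1)" using qQ by (intro mult_right_mono) auto
      finally have "\<bar>p\<bar> \<le> P" unfolding P_def by linarith
      then have "(p, q) \<in> {-P..P} \<times> {0..Q}" using qQ q0 by auto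
      then show "r \<in> (\<lambda>(p, q). Rat.Fract p q) ` ({-P..P} \<times> {0..Q})" unfolding r_eq by (intro image_eqI[of _ _ "(p, q)"]) auto
    qed
    then show ?thesis by (rule finite_subset) auto
  qed
  moreover have "infinite (S 2)" unfolding S_def using irr by (rule infinite_quadratic_approximations)
  ultimately have "(SUP mu\<in>{mu. infinite (S mu)}. ereal mu) = ereal 2"
    by (intro antisym SUP_least SUP_upper) (auto simp: not_less[symmetric])
  then show ?thesis by (simp add: irrationality_exponent_def S_def)
qed

section \<open>Values of the product\<close>

lemma poly_of_int_poly_eq_sum:
  assumes "degree P \<le> n"
  shows "poly (of_int_poly P) y = (\<Sum>i\<le>n. of_int (coeff P i) * (y :: real) ^ i)"
proof -
  have "poly (of_int_poly P) y = (\<Sum>i\<le>degree P. of_int (coeff P i) * y ^ i)"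
    by (simp add: poly_altdef degree_map_poly coeff_map_poly)
  also have "\<dots> = (\<Sum>i\<le>n. of_int (coeff P i) * y ^ i)"
    using assms by (intro sum.mono_neutral_left) (auto simp: coeff_eq_0)
  finally show ?thesis .
qed

text \<open>For \<open>n\<close> at least the degree this is the integer
  \<open>B ^ n * P (1 / B)\<close>. The free parameter \<open>n\<close> lets different polynomials
  share one power of \<open>B\<close>.\<close>

definition homogeneous_value :: "int poly \<Rightarrow> nat \<Rightarrow> int \<Rightarrow> int" where
  "homogeneous_value P n B = (\<Sum>i\<le>n. coeff P i * B ^ (n - i))"

lemma of_int_homogeneous_value:
  assumes "degree P \<le> n" "B \<noteq> 0"
  shows "real_of_int (homogeneous_value P n B) = of_int B ^ n * poly (of_int_poly P) (1 / of_int B)"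
proof -
  have "of_int B ^ n * poly (of_int_poly P) (1 / of_int B) =
      (\<Sum>i\<le>n. real_of_int B ^ n * (of_int (coeff P i) * (1 / of_int B) ^ i))"
    by (simp only: poly_of_int_poly_eq_sum[OF assms(1)] sum_distrib_left)
  also have "\<dots> = (\<Sum>i\<le>n. of_int (coeff P i) * of_int B ^ (n - i))"
    using assms(2) by (intro sum.cong refl) (simp add: power_diff field_simps)
  finally show ?thesis by (simp add: homogeneous_value_def)
qed

lemma poly_of_int_poly_bound:
  fixes y :: real
  assumes "\<bar>y\<bar> \<le> 1"
  shows "\<bar>poly (of_int_poly P) y\<bar> \<le> (\<Sum>i\<le>degree P. \<bar>of_int (coeff P i)\<bar>)"
proof -
  have "\<bar>poly (of_int_poly P) y\<bar> \<le> (\<Sum>i\<le>degree P. \<bar>of_int (coeff P i) * y ^ i\<bar>)"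
    unfolding poly_of_int_poly_eq_sum[OF order_refl] by (rule sum_abs)
  also have "\<dots> \<le> (\<Sum>i\<le>degree P. \<bar>of_int (coeff P i)\<bar>)"
    using assms by (intro sum_mono) (simp add: abs_mult power_abs power_le_one mult_left_le)
  finally show ?thesis .
qed

lemma prod_lessThan_LIMSEQ_prodinf:
  fixes f :: "nat \<Rightarrow> real"
  assumes "convergent_prod f"
  shows "(\<lambda>n. \<Prod>i<n. f i) \<longlonglongrightarrow> prodinf f"
  using convergent_prod_LIMSEQ[OF assms] by (simp add: LIMSEQ_lessThan_iff_atMost)

lemma nonzero_LIMSEQ_bounds:
  fixes s :: "nat \<Rightarrow> real"
  assumes "s \<longlonglongrightarrow> L" "L \<noteq> 0" "\<And>n. s n \<noteq> 0"
  obtains K where "K \<ge> 1" "\<And>n. 1 / K \<le> \<bar>s n\<bar>" "\<And>n. \<bar>s n\<bar> \<le> K"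
proof -
  have "Bseq s" using assms(1) by (intro convergent_imp_Bseq convergentI)
  then obtain K1 where K1: "K1 > 0" "\<And>n. \<bar>s n\<bar> \<le> K1" by (auto elim!: BseqE)
  have "(\<lambda>n. inverse (s n)) \<longlonglongrightarrow> inverse L" using assms by (intro tendsto_inverse)
  then have "Bseq (\<lambda>n. inverse (s n))" by (intro convergent_imp_Bseq convergentI)
  then obtain K2 where K2: "K2 > 0" "\<And>n. \<bar>inverse (s n)\<bar> \<le> K2" by (auto elim!: BseqE)
  define K where "K = max 1 (max K1 K2)"
  show ?thesis
  proof (rule that[of K])
    show "K \<ge> 1" by (simp add: K_def)
    show "\<bar>s n\<bar> \<le> K" for n using K1(2)[of n] by (simp add: K_def)
    show "1 / K \<le> \<bar>s n\<bar>" for n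
    proof -
      have "1 / \<bar>s n\<bar> \<le> K" using K2(2)[of n] by (simp add: K_def inverse_eq_divide)
      then show ?thesis using assms(3)[of n] by (simp add: K_def field_simps)
    qed
  qed
qed

text \<open>With R the sum of the absolute values of all coefficients of D and N, the recursion
  gains at most one factor R per step. This makes the radius of convergence positive.\<close>

lemma functional_eq_coeff_bound:
  fixes F :: "int fps" and D N :: "int poly"
  assumes D0: "coeff D 0 = 1" and F0: "fps_nth F 0 = 1"
    and feq: "fps_of_poly D * F = fps_of_poly N * fps_sq F"
  obtains R :: int where "R \<ge> 1" "\<And>n. \<bar>fps_nth F n\<bar> \<le> R ^ n"
proof -
  define S where "S = (\<lambda>P :: int poly. \<Sum>i\<le>degree P. \<bar>coeff P i\<bar>)"
  have S_le: "(\<Sum>i\<in>A. \<bar>coeff P i\<bar>) \<le> S P" if "finite A" for P and A :: "nat set"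
  proof -
    have "(\<Sum>i\<in>A. \<bar>coeff P i\<bar>) \<le> (\<Sum>i\<in>A \<union> {..degree P}. \<bar>coeff P i\<bar>)"
      using that by (intro sum_mono2) auto
    also have "\<dots> = S P" unfolding S_def using that by (intro sum.mono_neutral_right) (auto simp: coeff_eq_0)
    finally show ?thesis .
  qed
  define R where "R = S D + S N"
  have "S N \<ge> 0" by (simp add: S_def sum_nonneg)
  moreover have "S D \<ge> 1" using S_le[of "{0}" D] D0 by simp
  ultimately have R1: "R \<ge> 1" by (simp add: R_def)
  show ?thesis
  proof (rule that[OF R1])
    fix n show "\<bar>fps_nth F n\<bar> \<le> R ^ n"
    proof (induction n rule: less_induct)
      case (less n)
      show ?case
      proof (cases n)
        case (Suc m)
        have bound: "\<bar>fps_nth F k\<bar> \<le> R ^ m" if "k \<le> m" for k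
          using less.IH[of k] power_increasing[OF that R1] that Suc by simp
        have "fps_nth (fps_of_poly D * F) n = fps_nth F n + (\<Sum>i=1..n. coeff D i * fps_nth F (n - i))"
          by (simp add: fps_mult_nth sum.atLeast_Suc_atMost D0)
        then have "fps_nth F n = (\<Sum>i=0..n. coeff N i * fps_nth (fps_sq F) (n - i))
            - (\<Sum>i=1..n. coeff D i * fps_nth F (n - i))"
          unfolding feq by (simp add: fps_mult_nth)
        then have "\<bar>fps_nth F n\<bar> \<le> \<bar>\<Sum>i=0..n. coeff N i * fps_nth (fps_sq F) (n - i)\<bar>
            + \<bar>\<Sum>i=1..n. coeff D i * fps_nth F (n - i)\<bar>"
          by linarith
        also have "\<bar>\<Sum>i=0..n. coeff N i * fps_nth (fps_sq F) (n - i)\<bar> \<le> (\<Sum>i=0..n. \<bar>coeff N i\<bar> * R ^ m)"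
        proof (intro order_trans[OF sum_abs] sum_mono)
          fix i
          have "\<bar>fps_nth (fps_sq F) (n - i)\<bar> \<le> R ^ m"
            using R1 Suc by (auto simp: fps_sq_nth intro!: bound)
          then show "\<bar>coeff N i * fps_nth (fps_sq F) (n - i)\<bar> \<le> \<bar>coeff N i\<bar> * R ^ m"
            by (simp add: abs_mult mult_left_mono)
        qed
        also have "\<dots> \<le> S N * R ^ m"
          unfolding sum_distrib_right[symmetric] using R1 by (intro mult_right_mono S_le) auto
        also have "\<bar>\<Sum>i=1..n. coeff D i * fps_nth F (n - i)\<bar> \<le> (\<Sum>i=1..n. \<bar>coeff D i\<bar> * R ^ m)"
        proof (intro order_trans[OF sum_abs] sum_mono)
          fix i assume "i \<in> {1..n}"
          then have "\<bar>fps_nth F (n - i)\<bar> \<le> R ^ m" using Suc by (intro bound) auto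
          then show "\<bar>coeff D i * fps_nth F (n - i)\<bar> \<le> \<bar>coeff D i\<bar> * R ^ m"
            by (simp add: abs_mult mult_left_mono)
        qed
        also have "\<dots> \<le> S D * R ^ m"
          unfolding sum_distrib_right[symmetric] using R1 by (intro mult_right_mono S_le) auto
        finally show ?thesis by (simp add: R_def Suc algebra_simps)
      qed (simp add: F0)
    qed
  qed
qed

lemma sums_fps_sq:
  fixes f :: "real fps"
  assumes "ereal \<bar>y ^ 2\<bar> < fps_conv_radius f"
  shows "(\<lambda>n. fps_nth (fps_sq f) n * y ^ n) sums eval_fps f (y ^ 2)"
proof -
  have "(\<lambda>n. fps_nth f n * (y ^ 2) ^ n) sums eval_fps f (y ^ 2)"
    using assms by (intro sums_eval_fps) simp
  from sums_if[OF sums_zero this]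
  have "(\<lambda>n. if even n then fps_nth f (n div 2) * (y ^ 2) ^ (n div 2) else 0) sums eval_fps f (y ^ 2)"
    by simp
  moreover have "(\<lambda>n. if even n then fps_nth f (n div 2) * (y ^ 2) ^ (n div 2) else 0)
      = (\<lambda>n. fps_nth (fps_sq f) n * y ^ n)"
    by (auto simp: fun_eq_iff fps_sq_nth power_mult[symmetric])
  ultimately show ?thesis by simp
qed

lemma eval_fps_functional_eq:
  fixes f :: "real fps"
  assumes feq: "fps_of_poly p * f = fps_of_poly q * fps_sq f"
    and r: "0 < r" "r \<le> 1" "ereal r < fps_conv_radius f" and y: "\<bar>y\<bar> < r"
  shows "poly p y * eval_fps f y = poly q y * eval_fps f (y ^ 2)"
proof -
  \<comment> \<open>As \<open>r \<le> 1\<close>, squaring maps the disc of radius \<open>r\<close>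
    into itself.\<close>
  have sq_less: "ereal \<bar>t ^ 2\<bar> < fps_conv_radius f" if "\<bar>t\<bar> \<le> r" for t
  proof -
    have "\<bar>t ^ 2\<bar> \<le> r" using that r mult_mono[of "\<bar>t\<bar>" r "\<bar>t\<bar>" 1] by (simp add: power2_eq_square abs_mult)
    then show ?thesis using r(3) by (meson ereal_less_eq(3) le_less_trans)
  qed
  have "summable (\<lambda>n. fps_nth (fps_sq f) n * r ^ n)"
    using sums_fps_sq[OF sq_less[of r]] r by (auto simp: sums_iff)
  then have rad: "fps_conv_radius (fps_sq f) \<ge> r"
    unfolding fps_conv_radius_def using conv_radius_geI[of "fps_nth (fps_sq f)" r] r by simp
  have y1: "ereal (norm y) < fps_conv_radius f"
    using y r by (metis ereal_less_eq(3) le_less_trans less_imp_le real_norm_def)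
  have y2: "ereal (norm y) < fps_conv_radius (fps_sq f)"
    using y rad by (metis less_le_trans real_norm_def less_ereal.simps(1))
  have "poly p y * eval_fps f y = eval_fps (fps_of_poly p * f) y"
    using y1 by (simp add: eval_fps_mult)
  also have "\<dots> = poly q y * eval_fps (fps_sq f) y"
    unfolding feq using y2 by (simp add: eval_fps_mult)
  also have "eval_fps (fps_sq f) y = eval_fps f (y ^ 2)"
    unfolding eval_fps_def[of "fps_sq f"] using sums_fps_sq[OF sq_less[of y]] y by (simp add: sums_iff)
  finally show ?thesis .
qed

text \<open>After division by the power of z at the order of E, the cofactor is continuous and
  nonzero at 0. The upper bound measures the quality of an approximation, the lower one shows that
  it is not exact.\<close>

lemma eval_fps_leading_term:
  fixes E :: "real fps" and x :: "nat \<Rightarrow> real"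
  assumes E: "E \<noteq> 0" "fps_conv_radius E > 0" and x: "x \<longlonglongrightarrow> 0" "\<And>m. x m > 0"
  obtains K m0 where "K \<ge> 1" "\<forall>m\<ge>m0. x m ^ subdegree E / K \<le> \<bar>eval_fps E (x m)\<bar> \<and>
    \<bar>eval_fps E (x m)\<bar> \<le> K * x m ^ subdegree E"
proof -
  define s where "s = subdegree E"
  define S where "S = fps_shift s E"
  have rad: "fps_conv_radius S > 0" using E by (simp add: S_def)
  define e where "e = \<bar>fps_nth E s\<bar>"
  have e: "e > 0" using E by (simp add: e_def s_def)
  have "isCont (eval_fps S) 0" using rad by (intro continuous_eval_fps) (simp add: zero_ereal_def)
  then have "(\<lambda>m. eval_fps S (x m)) \<longlonglongrightarrow> eval_fps S 0" using x(1) by (rule isCont_tendsto_compose)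
  then have lim: "(\<lambda>m. \<bar>eval_fps S (x m)\<bar>) \<longlonglongrightarrow> e"
    unfolding e_def using tendsto_rabs by (fastforce simp: eval_fps_at_0 S_def)
  have "\<forall>\<^sub>F m in sequentially. ereal (x m) < fps_conv_radius E"
  proof -
    obtain r where r: "0 < r" "ereal r < fps_conv_radius E"
      using ereal_dense2[OF E(2)] by (auto simp: zero_ereal_def)
    have "\<forall>\<^sub>F m in sequentially. x m < r" using x(1) r(1) by (rule order_tendstoD(2))
    then show ?thesis by eventually_elim (use r(2) in \<open>meson less_ereal.simps(1) less_trans\<close>)
  qed
  moreover have "\<forall>\<^sub>F m in sequentially. e / 2 < \<bar>eval_fps S (x m)\<bar>"
    using e by (intro order_tendstoD(1)[OF lim]) simp
  moreover have "\<forall>\<^sub>F m in sequentially. \<bar>eval_fps S (x m)\<bar> < 2 * e"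
    using e by (intro order_tendstoD(2)[OF lim]) simp
  ultimately have "\<forall>\<^sub>F m in sequentially. e / 2 * x m ^ s \<le> \<bar>eval_fps E (x m)\<bar> \<and> \<bar>eval_fps E (x m)\<bar> \<le> 2 * e * x m ^ s"
  proof eventually_elim
    case (elim m)
    have "eval_fps S (x m) = eval_fps E (x m) / x m ^ s"
      unfolding S_def using elim(1) x(2)[of m] by (subst eval_fps_shift) (auto simp: s_def)
    then have "\<bar>eval_fps E (x m)\<bar> = \<bar>eval_fps S (x m)\<bar> * x m ^ s"
      using x(2)[of m] by (simp add: abs_mult)
    then show ?case using elim(2,3) x(2)[of m] by (auto intro!: mult_right_mono)
  qed
  then obtain m0 where m0: "\<And>m. m \<ge> m0 \<Longrightarrow> e / 2 * x m ^ s \<le> \<bar>eval_fps E (x m)\<bar> \<and> \<bar>eval_fps E (x m)\<bar> \<le> 2 * e * x m ^ s"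
    unfolding eventually_sequentially by blast
  define K where "K = max 1 (max (2 / e) (2 * e))"
  have K: "K \<ge> 1" "2 * e \<le> K" "1 / K \<le> e / 2"
  proof -
    have "2 / e \<le> K" by (simp add: K_def)
    then show "1 / K \<le> e / 2" using e by (simp add: K_def field_simps)
  qed (auto simp: K_def)
  show ?thesis
  proof (rule that[OF K(1)], intro allI impI conjI)
    fix m assume m: "m \<ge> m0"
    have "1 / K * x m ^ s \<le> e / 2 * x m ^ s" using K(3) x(2)[of m] by (intro mult_right_mono) auto
    moreover have "x m ^ s / K = 1 / K * x m ^ s" by simp
    ultimately show "x m ^ subdegree E / K \<le> \<bar>eval_fps E (x m)\<bar>"
      unfolding s_def[symmetric] using m0[OF m] by linarith
    have "2 * e * x m ^ s \<le> K * x m ^ s" using K(2) x(2)[of m] by (intro mult_right_mono) auto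
    then show "\<bar>eval_fps E (x m)\<bar> \<le> K * x m ^ subdegree E" using m0[OF m] by (simp add: s_def)
  qed
qed

section \<open>Values of the product at the points b^(-2^m)\<close>

locale mahler_product =
  fixes u :: int and C D :: "int poly" and b :: int
  assumes D_0: "coeff D 0 = 1" and b_ge_2: "b \<ge> 2"
    and nonvanishing: "\<And>m. poly (of_int_poly D) (1 / real_of_int b ^ (2 ^ m))
                   * mprod_val u C D (1 / real_of_int b ^ (2 ^ m)) \<noteq> 0"
    and not_rational: "\<not> rational_mod4 (mprod_fps u C D)"
begin

definition N :: "int poly" where "N = factor_numerator u C D"
definition X :: "nat \<Rightarrow> int" where "X m = b ^ 2 ^ m"
definition x :: "nat \<Rightarrow> real" where "x m = 1 / of_int (X m)"
definition val :: "nat \<Rightarrow> real" where "val m = mprod_val u C D (x m)"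

abbreviation peval :: "int poly \<Rightarrow> nat \<Rightarrow> real" where
  "peval P m \<equiv> poly (of_int_poly P) (x m)"

lemma N_0: "coeff N 0 = 1"
  by (simp add: N_def factor_numerator_def coeff_mult D_0)

lemma D_nz: "D \<noteq> 0" and N_nz: "N \<noteq> 0"
  using D_0 N_0 by auto

lemma X_ge: "X m \<ge> 2 ^ (m + 1)"
proof -
  have "m + 1 \<le> 2 ^ m" using less_exp[of m] by linarith
  then have "(2::int) ^ (m + 1) \<le> 2 ^ 2 ^ m" by (intro power_increasing) auto
  also have "\<dots> \<le> X m" unfolding X_def using b_ge_2 by (intro power_mono) auto
  finally show ?thesis .
qed

lemma X_ge_2: "X m \<ge> 2"
  unfolding X_def using b_ge_2 power_increasing[of 1 "2 ^ m" b] by simp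

lemma x_pos: "x m > 0" and x_le: "x m \<le> (1 / 2) ^ m" and x_le_1: "x m \<le> 1"
proof -
  have X: "real_of_int (X m) \<ge> 2 ^ (m + 1)"
    using X_ge[of m] by (metis of_int_le_iff of_int_numeral of_int_power)
  then have X': "real_of_int (X m) > 0" using X_ge_2[of m] by simp
  then show "x m > 0" by (simp add: x_def)
  have "(2 :: real) ^ m \<le> of_int (X m)" 
    using X power_increasing[of m "m + 1" "2 :: real"] by linarith
  then have "x m \<le> 1 / 2 ^ m" unfolding x_def by (intro frac_le) auto
  then show "x m \<le> (1 / 2) ^ m" by (simp add: power_divide)
  also have "(1 / 2 :: real) ^ m \<le> 1" by (simp add: power_le_one)
  finally show "x m \<le> 1" .
qed

lemma x_power: "x m ^ 2 ^ n = x (m + n)"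
  by (simp add: x_def X_def power_divide power_add flip: power_mult)

lemma x_Suc: "x m ^ 2 = x (Suc m)"
  using x_power[of m 1] by simp

lemma x_LIMSEQ: "x \<longlonglongrightarrow> 0"
proof (rule tendsto_sandwich[OF _ _ tendsto_const])
  show "(\<lambda>m. (1 / 2 :: real) ^ m) \<longlonglongrightarrow> 0" by (intro LIMSEQ_power_zero) simp
qed (auto intro!: always_eventually simp: x_le less_imp_le[OF x_pos])

lemma eventually_x_less_radius:
  assumes "R > 0"
  shows "\<forall>\<^sub>F m in sequentially. ereal (x m) < R"
proof -
  obtain r where r: "0 < r" "ereal r < R"
    using ereal_dense2[OF assms] by (auto simp: zero_ereal_def)
  have "\<forall>\<^sub>F m in sequentially. x m < r" using x_LIMSEQ r(1) by (rule order_tendstoD(2))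
  then show ?thesis by eventually_elim (use r(2) in \<open>meson less_ereal.simps(1) less_trans\<close>)
qed

lemma D_nonzero: "peval D m \<noteq> 0" and val_nonzero: "val m \<noteq> 0"
  using nonvanishing[of m] by (auto simp: val_def x_def X_def)

lemma convergent_prod_poly:
  assumes "coeff P 0 = 1"
  shows "convergent_prod (\<lambda>n. peval P (m + n))"
proof -
  obtain P' where P': "P = pCons 1 P'" using assms by (cases P) auto
  define K where "K = (\<Sum>i\<le>degree P'. \<bar>real_of_int (coeff P' i)\<bar>)"
  have bound: "norm (norm (peval P (m + n) - 1)) \<le> K * (1 / 2) ^ n" for n
  proof -
    have "peval P (m + n) - 1 = x (m + n) * peval P' (m + n)" by (simp add: P' map_poly_pCons)
    then have "\<bar>peval P (m + n) - 1\<bar> = x (m + n) * \<bar>peval P' (m + n)\<bar>"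
      using x_pos[of "m + n"] by (simp add: abs_mult)
    also have "\<dots> \<le> x (m + n) * K"
      unfolding K_def using x_pos[of "m + n"] x_le_1[of "m + n"] by (intro mult_left_mono poly_of_int_poly_bound) auto
    also have "\<dots> \<le> (1 / 2) ^ n * K"
    proof (rule mult_right_mono)
      have "(1 / 2 :: real) ^ (m + n) \<le> (1 / 2) ^ n" by (intro power_decreasing) auto
      then show "x (m + n) \<le> (1 / 2) ^ n" using x_le[of "m + n"] by linarith
    qed (simp add: K_def sum_nonneg)
    finally show ?thesis by (simp add: mult.commute)
  qed
  have "summable (\<lambda>n. K * (1 / 2 :: real) ^ n)" by (intro summable_mult summable_geometric) simp
  then have "summable (\<lambda>n. norm (peval P (m + n) - 1))"
    using bound by (rule summable_comparison_test'[where N = 0])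
  then show ?thesis
    by (intro abs_convergent_prod_imp_convergent_prod) (simp add: abs_convergent_prod_conv_summable)
qed

lemma convergent_prod_quotient: "convergent_prod (\<lambda>n. peval N (m + n) / peval D (m + n))"
  by (intro convergent_prod_divide convergent_prod_poly D_0 N_0)

lemma val_eq_prodinf: "val m = (\<Prod>n. peval N (m + n) / peval D (m + n))"
proof -
  have "1 + of_int u * x m ^ 2 ^ n + 2 * x m ^ 2 ^ (n + 1) * poly (of_int_poly C) (x m ^ 2 ^ n)
      / poly (of_int_poly D) (x m ^ 2 ^ n) = peval N (m + n) / peval D (m + n)" for n
  proof -
    have "x m ^ 2 ^ (n + 1) = x (m + n) ^ 2" unfolding x_power x_Suc by simp
    moreover have "peval N (m + n) = (1 + of_int u * x (m + n)) * peval D (m + n)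
        + 2 * x (m + n) ^ 2 * peval C (m + n)"
      unfolding N_def factor_numerator_def of_int_poly_add of_int_poly_mult
      by (simp add: map_poly_pCons power2_eq_square algebra_simps)
    ultimately show ?thesis unfolding x_power using D_nonzero[of "m + n"] by (simp add: field_simps)
  qed
  then show ?thesis by (simp add: val_def mprod_val_def)
qed

lemma partial_products_LIMSEQ_val: "(\<lambda>k. \<Prod>j<k. peval N (m + j) / peval D (m + j)) \<longlonglongrightarrow> val m"
  unfolding val_eq_prodinf by (intro prod_lessThan_LIMSEQ_prodinf convergent_prod_quotient)

text \<open>Derived from the product and not from the power series, because for small m the point
  \<open>x m\<close> may lie outside the disc of convergence.\<close>

lemma val_Suc: "val m = peval N m / peval D m * val (Suc m)"
proof (rule LIMSEQ_unique)
  show "(\<lambda>k. \<Prod>j<Suc k. peval N (m + j) / peval D (m + j)) \<longlonglongrightarrow> val m"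
    using partial_products_LIMSEQ_val by (rule LIMSEQ_Suc)
  show "(\<lambda>k. \<Prod>j<Suc k. peval N (m + j) / peval D (m + j)) \<longlonglongrightarrow> peval N m / peval D m * val (Suc m)"
    unfolding prod.lessThan_Suc_shift
    using tendsto_mult_left[OF partial_products_LIMSEQ_val[of "Suc m"], of "peval N m / peval D m"] by simp
qed

text \<open>The nonvanishing hypothesis enters here: a zero of N at \<open>x m\<close> would make
  \<open>val m\<close> zero, and with it all partial numerators from there on.\<close>

lemma N_nonzero: "peval N m \<noteq> 0"
  using val_Suc[of m] val_nonzero[of m] by auto

text \<open>One common degree for D and N, so that the powers of \<open>X m\<close> introduced by
  clearing denominators agree on both sides of \<open>val_cleared\<close>.\<close>

definition \<delta> :: nat where "\<delta> = max (degree D) (degree N)"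

lemma degree_D: "degree D \<le> \<delta>" and degree_N: "degree N \<le> \<delta>"
  by (simp_all add: \<delta>_def)

definition cleared :: "int poly \<Rightarrow> nat \<Rightarrow> int" where
  "cleared P m = (\<Prod>j<m. homogeneous_value P \<delta> (X j))"

lemma of_int_homogeneous_value_X:
  "degree P \<le> n \<Longrightarrow> real_of_int (homogeneous_value P n (X m)) = of_int (X m) ^ n * peval P m"
  using X_ge_2[of m] by (simp add: of_int_homogeneous_value x_def)

text \<open>The exponents 1, 2, ..., 2^(m-1) add up to 2^m - 1. Clearing the denominators of m
  factors therefore costs only a fixed power of \<open>X m\<close>, up to a constant.\<close>

lemma X_prod: "b * (\<Prod>j<m. X j) = X m"
proof (induction m)
  case (Suc m)
  have "b * (\<Prod>j<Suc m. X j) = (b * (\<Prod>j<m. X j)) * X m" by simp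
  also have "\<dots> = X (Suc m)" unfolding Suc by (simp add: X_def mult_2 flip: power_add)
  finally show ?case .
qed (simp add: X_def)

lemma of_int_cleared:
  assumes "degree P \<le> \<delta>"
  shows "real_of_int (cleared P m) = (of_int (X m) / of_int b) ^ \<delta> * (\<Prod>j<m. peval P j)"
proof -
  have "real_of_int (X m) / of_int b = (\<Prod>j<m. real_of_int (X j))"
    using b_ge_2 arg_cong[OF X_prod[of m], of real_of_int] by (simp add: field_simps)
  then show ?thesis
    using assms by (simp add: cleared_def of_int_homogeneous_value_X prod.distrib prod_power_distrib)
qed

lemma val_cleared: "val 0 * of_int (cleared D m) = val m * of_int (cleared N m)"
proof -
  have "val 0 * (\<Prod>j<m. peval D j) = val m * (\<Prod>j<m. peval N j)"
  proof (induction m)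
    case (Suc m)
    have "val 0 * (\<Prod>j<Suc m. peval D j) = (val m * (\<Prod>j<m. peval N j)) * peval D m"
      using Suc by (simp add: mult_ac)
    also have "val m = peval N m / peval D m * val (Suc m)" by (rule val_Suc)
    finally show ?case using D_nonzero[of m] by (simp add: mult_ac)
  qed simp
  then show ?thesis by (simp add: of_int_cleared \<delta>_def)
qed

text \<open>The infinite product of the values of P converges to a nonzero limit, so its partial
  products stay between positive constants in absolute value.\<close>

lemma cleared_bounds:
  assumes P: "coeff P 0 = 1" "degree P \<le> \<delta>" and nz: "\<And>m. peval P m \<noteq> 0"
  obtains K where "K \<ge> 1" "\<forall>m. of_int (X m) ^ \<delta> / K \<le> \<bar>real_of_int (cleared P m)\<bar> \<and>
    \<bar>real_of_int (cleared P m)\<bar> \<le> K * of_int (X m) ^ \<delta>"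
proof -
  have conv: "convergent_prod (\<lambda>n. peval P n)" using convergent_prod_poly[OF P(1), of 0] by simp
  obtain K where K: "K \<ge> 1" "\<And>m. 1 / K \<le> \<bar>\<Prod>j<m. peval P j\<bar>" "\<And>m. \<bar>\<Prod>j<m. peval P j\<bar> \<le> K"
    using nonzero_LIMSEQ_bounds[OF prod_lessThan_LIMSEQ_prodinf[OF conv] prodinf_nonzero[OF conv nz]] nz by auto
  define B where "B = real_of_int b ^ \<delta>"
  have B: "B \<ge> 1" unfolding B_def using b_ge_2 by (intro one_le_power) simp
  have eq: "\<bar>real_of_int (cleared P m)\<bar> = of_int (X m) ^ \<delta> / B * \<bar>\<Prod>j<m. peval P j\<bar>" for m
    using X_ge_2[of m] b_ge_2 by (simp add: of_int_cleared[OF P(2)] abs_mult power_divide B_def)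
  have Y: "real_of_int (X m) ^ \<delta> > 0" for m using X_ge_2[of m] by simp
  show ?thesis
  proof (rule that[of "B * K"], goal_cases)
    case 1
    show "1 \<le> B * K" using B K(1) mult_mono[of 1 B 1 K] by simp
  next
    case 2
    show ?case
    proof (intro allI conjI)
      fix m
      show "of_int (X m) ^ \<delta> / (B * K) \<le> \<bar>real_of_int (cleared P m)\<bar>"
        using mult_left_mono[OF K(2)[of m], of "of_int (X m) ^ \<delta> / B"] Y[of m] B unfolding eq by simp
      have "of_int (X m) ^ \<delta> / B * \<bar>\<Prod>j<m. peval P j\<bar> \<le> of_int (X m) ^ \<delta> / B * K"
        using K(3)[of m] Y[of m] B by (intro mult_left_mono) auto
      also have "\<dots> \<le> of_int (X m) ^ \<delta> * B * K"
      proof (intro mult_right_mono)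
        have "of_int (X m) ^ \<delta> / B \<le> of_int (X m) ^ \<delta>" using Y[of m] B by (simp add: divide_le_eq_1 field_simps)
        also have "\<dots> \<le> of_int (X m) ^ \<delta> * B" using Y[of m] B by simp
        finally show "of_int (X m) ^ \<delta> / B \<le> of_int (X m) ^ \<delta> * B" .
      qed (use K in auto)
      finally show "\<bar>real_of_int (cleared P m)\<bar> \<le> B * K * of_int (X m) ^ \<delta>" unfolding eq by (simp add: mult_ac)
    qed
  qed
qed

text \<open>For large m both \<open>val\<close> and the series obey the same recursion. After k
  steps the partial products tend to \<open>val m\<close>, while the series at
  \<open>x (m + k)\<close> tends to its constant term 1, which identifies the two.\<close>

lemma series_data:
  obtains F :: "int fps" and c where "F \<noteq> 0" "fps_conv_radius (of_int_fps F :: real fps) > 0"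
    "\<exists>m0. \<forall>m\<ge>m0. val m = eval_fps (of_int_fps F) (x m)"
    "\<forall>P Q n. P \<noteq> 0 \<or> Q \<noteq> 0 \<longrightarrow> degree P \<le> n \<longrightarrow> degree Q \<le> n \<longrightarrow>
      (\<exists>i\<le>2 * n + c. fps_nth (fps_of_poly Q * F - fps_of_poly P) i \<noteq> 0)"
    "fps_of_poly D * F = fps_of_poly N * fps_sq F"
proof -
  obtain F :: "int fps" where F: "of_int_fps F = mprod_fps u C D" "fps_nth F 0 = 1"
    and feq: "fps_of_poly D * F = fps_of_poly N * fps_sq F"
    using mprod_fps_integral[OF D_0] unfolding N_def by blast
  obtain c where bad: "\<forall>P Q n. P \<noteq> 0 \<or> Q \<noteq> 0 \<longrightarrow> degree P \<le> n \<longrightarrow> degree Q \<le> n \<longrightarrow>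
      (\<exists>i\<le>2 * n + c. fps_nth (fps_of_poly Q * F - fps_of_poly P) i \<noteq> 0)"
    using badly_approximable[OF D_0 F(2) feq[unfolded N_def]] not_rational F(1) by metis
  obtain R :: int where R: "R \<ge> 1" "\<And>n. \<bar>fps_nth F n\<bar> \<le> R ^ n"
    using functional_eq_coeff_bound[OF D_0 F(2) feq] by blast
  define f where "f = (of_int_fps F :: real fps)"
  define r where "r = 1 / (2 * real_of_int R)"
  have R': "real_of_int R \<ge> 1" using R(1) by simp
  have r: "0 < r" "r \<le> 1" using R' by (auto simp: r_def field_simps)
  have "summable (\<lambda>n. fps_nth f n * r ^ n)"
  proof (rule summable_comparison_test'[where N = 0])
    show "summable (\<lambda>n. (1 / 2 :: real) ^ n)" by (intro summable_geometric) simp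
    fix n
    have "\<bar>real_of_int (fps_nth F n)\<bar> \<le> of_int R ^ n" using R(2)[of n] by (metis of_int_abs of_int_le_iff of_int_power)
    then have "\<bar>real_of_int (fps_nth F n)\<bar> * r ^ n \<le> of_int R ^ n * r ^ n"
      using r by (intro mult_right_mono) auto
    also have "\<dots> = (1 / 2) ^ n" using R' by (simp add: r_def flip: power_mult_distrib)
    finally show "norm (fps_nth f n * r ^ n) \<le> (1 / 2) ^ n" using r by (simp add: f_def abs_mult)
  qed
  then have rad: "fps_conv_radius f \<ge> r"
    unfolding fps_conv_radius_def using conv_radius_geI[of "fps_nth f" r] r by simp
  then have rad0: "fps_conv_radius f > 0" using r by (metis ereal_less(2) less_le_trans)
  have "fps_of_poly (of_int_poly D) * f = fps_of_poly (of_int_poly N) * fps_sq f"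
    using arg_cong[OF feq, of "of_int_fps :: _ \<Rightarrow> real fps"]
    by (simp only: of_int_fps_mult of_int_fps_compose of_int_fps_of_poly f_def)
  moreover have "ereal (r / 2) < fps_conv_radius f"
  proof -
    have "ereal (r / 2) < ereal r" using r by simp
    then show ?thesis using rad by (rule less_le_trans)
  qed
  ultimately have eval: "poly (of_int_poly D) y * eval_fps f y = poly (of_int_poly N) y * eval_fps f (y ^ 2)"
    if "\<bar>y\<bar> < r / 2" for y
    using r that by (intro eval_fps_functional_eq[where r = "r / 2"]) auto
  have "\<forall>\<^sub>F m in sequentially. x m < r / 2" using x_LIMSEQ r by (intro order_tendstoD(2)) auto
  then obtain m0 where m0: "\<And>m. m \<ge> m0 \<Longrightarrow> x m < r / 2" unfolding eventually_sequentially by blast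
  have step: "eval_fps f (x m) = peval N m / peval D m * eval_fps f (x (Suc m))" if "m \<ge> m0" for m
    using eval[of "x m"] m0[OF that] x_pos[of m] D_nonzero[of m] by (simp add: x_Suc field_simps)
  have steps: "eval_fps f (x m) = (\<Prod>j<k. peval N (m + j) / peval D (m + j)) * eval_fps f (x (m + k))"
    if "m \<ge> m0" for m k
  proof (induction k)
    case (Suc k)
    then show ?case using step[of "m + k"] that by simp
  qed simp
  have "val m = eval_fps f (x m)" if "m \<ge> m0" for m
  proof (rule LIMSEQ_unique)
    have "isCont (eval_fps f) 0" using rad0 by (intro continuous_eval_fps) (simp add: zero_ereal_def)
    then have "(\<lambda>k. eval_fps f (x (k + m))) \<longlonglongrightarrow> eval_fps f 0"
      using LIMSEQ_ignore_initial_segment[OF x_LIMSEQ] by (rule isCont_tendsto_compose)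
    then have "(\<lambda>k. eval_fps f (x (m + k))) \<longlonglongrightarrow> 1"
      by (simp add: eval_fps_at_0 f_def F(2) add.commute)
    from tendsto_mult[OF partial_products_LIMSEQ_val[of m] this]
    show "(\<lambda>k. eval_fps f (x m)) \<longlonglongrightarrow> val m" by (simp only: steps[OF that, symmetric] mult_1_right)
  qed simp
  moreover have "F \<noteq> 0" using F(2) by auto
  ultimately show ?thesis using that[of F c] rad0 bad feq unfolding f_def by blast
qed

section \<open>Rational approximations from Pade approximants\<close>

lemma rational_approximations:
  obtains \<gamma> where "\<And>a. \<exists>K>0. \<exists>m0. \<forall>m\<ge>m0. \<exists>p q::int.
        \<bar>of_int q\<bar> \<le> K * (of_int b ^ 2 ^ m) ^ (a + \<gamma>) \<and>
        \<bar>of_int q * val 0 - of_int p\<bar> \<le> K / (of_int b ^ 2 ^ m) ^ a \<and>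
        1 / (K * (of_int b ^ 2 ^ m) ^ (a + \<gamma>)) \<le> \<bar>of_int q * val 0 - of_int p\<bar>"
proof -
  obtain F :: "int fps" and c where F: "F \<noteq> 0" "fps_conv_radius (of_int_fps F :: real fps) > 0"
    and val: "\<exists>m0. \<forall>m\<ge>m0. val m = eval_fps (of_int_fps F) (x m)"
    and bad: "\<forall>P Q n. P \<noteq> 0 \<or> Q \<noteq> 0 \<longrightarrow> degree P \<le> n \<longrightarrow> degree Q \<le> n \<longrightarrow>
      (\<exists>i\<le>2 * n + c. fps_nth (fps_of_poly Q * F - fps_of_poly P) i \<noteq> 0)"
    and "fps_of_poly D * F = fps_of_poly N * fps_sq F"
    by (rule series_data)
  obtain m1 where val: "\<And>m. m \<ge> m1 \<Longrightarrow> val m = eval_fps (of_int_fps F) (x m)" using val by blast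
  obtain KD where "KD \<ge> 1" "\<forall>m. of_int (X m) ^ \<delta> / KD \<le> \<bar>real_of_int (cleared D m)\<bar> \<and>
      \<bar>real_of_int (cleared D m)\<bar> \<le> KD * of_int (X m) ^ \<delta>"
    by (rule cleared_bounds[OF D_0 degree_D D_nonzero])
  then have KD: "KD \<ge> 1" "\<bar>real_of_int (cleared D m)\<bar> \<le> KD * of_int (X m) ^ \<delta>" for m
    by auto
  obtain KN where "KN \<ge> 1" "\<forall>m. of_int (X m) ^ \<delta> / KN \<le> \<bar>real_of_int (cleared N m)\<bar> \<and>
      \<bar>real_of_int (cleared N m)\<bar> \<le> KN * of_int (X m) ^ \<delta>"
    by (rule cleared_bounds[OF N_0 degree_N N_nonzero])
  then have KN: "KN \<ge> 1" "\<bar>real_of_int (cleared N m)\<bar> \<le> KN * of_int (X m) ^ \<delta>"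
    "of_int (X m) ^ \<delta> / KN \<le> \<bar>real_of_int (cleared N m)\<bar>" for m
    by auto
  define f where "f = (of_int_fps F :: real fps)"
  show ?thesis
  \<comment> \<open>The bound on \<open>q\<close> has exponent \<open>a + 2 * \<delta>\<close> and
    the lower bound on the error has exponent \<open>- (a + c)\<close>; the sum covers both and is
    independent of \<open>a\<close>.\<close>
  proof (rule that[of "2 * \<delta> + c"])
    fix a
    \<comment> \<open>Carrying the approximant from \<open>x m\<close> to \<open>x 0\<close>
      multiplies the error by \<open>cleared N m\<close>, of size \<open>X m ^ \<delta>\<close>; the
      extra degree \<open>\<delta>\<close> compensates.\<close>
    define n where "n = a + \<delta>"
    \<comment> \<open>The n coefficients of Q F with index n + 1, ..., 2 n are made to vanish by the
      n + 1 coefficients of Q; P takes over the lower ones.\<close>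
    obtain y where y: "\<exists>i\<in>{..n}. y i \<noteq> 0"
      "\<forall>k\<in>{n<..2 * n}. (\<Sum>i\<le>n. fps_nth F (k - i) * y i) = 0"
      using int_kernel_nontrivial[of "{n<..2 * n}" "{..n}" "\<lambda>k i. fps_nth F (k - i)"] by auto
    define Q where "Q = (\<Sum>i\<le>n. monom (y i) i)"
    have Q_coeff: "coeff Q i = (if i \<le> n then y i else 0)" for i
      by (simp add: Q_def coeff_sum)
    have "Q \<noteq> 0" using y(1) Q_coeff by (metis atMost_iff coeff_0)
    have degQ: "degree Q \<le> n" using Q_coeff by (intro degree_le) auto
    define P where "P = truncate_fps (Suc n) (fps_of_poly Q * F)"
    have degP: "degree P \<le> n" unfolding P_def using degree_truncate_fps[of "Suc n"] by (metis less_Suc_eq_le zero_less_Suc)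
    define E where "E = fps_of_poly Q * F - fps_of_poly P"
    have E_nth: "fps_nth E k = 0" if "k \<le> 2 * n" for k
    proof (cases "k \<le> n")
      case True
      then show ?thesis by (simp add: E_def P_def coeff_truncate_fps)
    next
      case False
      have "fps_nth E k = (\<Sum>i=0..k. coeff Q i * fps_nth F (k - i))"
        using False by (simp add: E_def P_def coeff_truncate_fps fps_mult_nth)
      also have "\<dots> = (\<Sum>i\<le>n. coeff Q i * fps_nth F (k - i))"
        using False Q_coeff by (intro sum.mono_neutral_right) auto
      also have "\<dots> = (\<Sum>i\<le>n. fps_nth F (k - i) * y i)"
        by (intro sum.cong) (auto simp: Q_coeff mult.commute)
      also have "\<dots> = 0" using y(2) False that by simp
      finally show ?thesis .
    qed
    obtain i where i: "i \<le> 2 * n + c" "fps_nth E i \<noteq> 0"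
      using bad[rule_format, of P Q n] \<open>Q \<noteq> 0\<close> degP degQ unfolding E_def by blast
    have E0: "E \<noteq> 0" using i by auto
    define s where "s = subdegree E"
    have s: "2 * n < s" "s \<le> 2 * n + c"
    proof -
      show "2 * n < s" unfolding s_def using E_nth E0 by (intro subdegree_greaterI) auto
      have "s \<le> i" unfolding s_def using i(2) by (rule subdegree_leI)
      then show "s \<le> 2 * n + c" using i(1) by simp
    qed
    define e where "e = (of_int_fps E :: real fps)"
    have e_eq: "e = fps_of_poly (of_int_poly Q) * f - fps_of_poly (of_int_poly P)"
      by (simp add: e_def E_def f_def of_int_fps_diff of_int_fps_mult)
    have e0: "e \<noteq> 0" unfolding e_def using E0 of_int_fps_eq_iff[of E 0, where ?'a = real] by simp
    have s_e: "subdegree e = s"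
      by (rule subdegreeI) (auto simp: e_def s_def E0)
    have rad_Qf: "fps_conv_radius (fps_of_poly (of_int_poly Q) * f) \<ge> fps_conv_radius f"
      using fps_conv_radius_mult[of "fps_of_poly (of_int_poly Q)" f] by simp
    have rad_f_e: "fps_conv_radius f \<le> fps_conv_radius e"
    proof -
      have "fps_conv_radius f \<le> min (fps_conv_radius (fps_of_poly (of_int_poly Q) * f))
          (fps_conv_radius (fps_of_poly (of_int_poly P) :: real fps))"
        using rad_Qf by simp
      also have "\<dots> \<le> fps_conv_radius e" unfolding e_eq by (rule fps_conv_radius_diff)
      finally show ?thesis .
    qed
    have rad_e: "fps_conv_radius e > 0"
      using F(2)[folded f_def] rad_f_e by (rule less_le_trans)
    obtain KE mE where "KE \<ge> 1" "\<forall>m\<ge>mE. x m ^ subdegree e / KE \<le> \<bar>eval_fps e (x m)\<bar> \<and>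
      \<bar>eval_fps e (x m)\<bar> \<le> KE * x m ^ subdegree e"
      by (rule eval_fps_leading_term[OF e0 rad_e x_LIMSEQ x_pos])
    then have KE: "KE \<ge> 1" "m \<ge> mE \<Longrightarrow> x m ^ s / KE \<le> \<bar>eval_fps e (x m)\<bar>"
      "m \<ge> mE \<Longrightarrow> \<bar>eval_fps e (x m)\<bar> \<le> KE * x m ^ s" for m
      unfolding s_e by auto
    obtain m2 where m2: "\<And>m. m \<ge> m2 \<Longrightarrow> ereal (x m) < fps_conv_radius f"
      using eventually_x_less_radius[OF F(2)] unfolding eventually_sequentially f_def by blast
    define KQ where "KQ = (\<Sum>i\<le>degree Q. \<bar>real_of_int (coeff Q i)\<bar>)"
    define K where "K = max (KD * (KQ + 1)) (KN * KE)"
    have KQ0: "KQ \<ge> 0" by (simp add: KQ_def sum_nonneg)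
    have K0: "K > 0"
    proof -
      have "KN * KE \<ge> 1" using KN(1) KE(1) mult_mono[of 1 KN 1 KE] by simp
      then show ?thesis by (simp add: K_def)
    qed
    show "\<exists>K>0. \<exists>m0. \<forall>m\<ge>m0. \<exists>p q::int.
        \<bar>of_int q\<bar> \<le> K * (of_int b ^ 2 ^ m) ^ (a + (2 * \<delta> + c)) \<and>
        \<bar>of_int q * val 0 - of_int p\<bar> \<le> K / (of_int b ^ 2 ^ m) ^ a \<and>
        1 / (K * (of_int b ^ 2 ^ m) ^ (a + (2 * \<delta> + c))) \<le> \<bar>of_int q * val 0 - of_int p\<bar>"
    proof (rule exI[of _ K], intro conjI K0, rule exI[of _ "max m1 (max mE m2)"], intro allI impI)
      fix m assume m: "m \<ge> max m1 (max mE m2)"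
      define Y where "Y = real_of_int (X m)"
      have Y: "Y \<ge> 1" "Y > 0" using X_ge_2[of m] by (auto simp: Y_def)
      have xY: "x m = 1 / Y" by (simp add: x_def Y_def)
      define q where "q = cleared D m * homogeneous_value Q n (X m)"
      define p where "p = cleared N m * homogeneous_value P n (X m)"
      have eval_e: "eval_fps e (x m) = peval Q m * val m - peval P m"
      proof -
        have *: "ereal (norm (x m)) < fps_conv_radius f" using m2[of m] m x_pos[of m] by simp
        then have "ereal (norm (x m)) < fps_conv_radius (fps_of_poly (of_int_poly Q) * f)"
          using rad_Qf by (rule less_le_trans)
        then show ?thesis
          unfolding e_eq using * val[of m] m by (simp add: eval_fps_diff eval_fps_mult f_def)
      qed
      have "of_int q * val 0 - of_int p = (val 0 * of_int (cleared D m)) * (Y ^ n * peval Q m) - of_int (cleared N m) * (Y ^ n * peval P m)"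
        using degP degQ by (simp add: q_def p_def of_int_homogeneous_value_X Y_def)
      also have "\<dots> = of_int (cleared N m) * Y ^ n * eval_fps e (x m)"
        unfolding val_cleared eval_e by (simp add: algebra_simps)
      finally have diff: "\<bar>of_int q * val 0 - of_int p\<bar> = \<bar>of_int (cleared N m)\<bar> * Y ^ n * \<bar>eval_fps e (x m)\<bar>"
        using Y by (simp add: abs_mult)
      have "\<bar>of_int q\<bar> = \<bar>of_int (cleared D m)\<bar> * Y ^ n * \<bar>peval Q m\<bar>"
        using degQ Y by (simp add: q_def of_int_homogeneous_value_X Y_def abs_mult)
      also have "\<dots> \<le> (KD * Y ^ \<delta>) * Y ^ n * KQ"
        unfolding KQ_def using KD(2)[of m] x_pos[of m] x_le_1[of m] KD(1) Y
        by (intro mult_mono poly_of_int_poly_bound) (auto simp: Y_def)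
      also have "\<dots> = KD * KQ * Y ^ (a + 2 * \<delta>)" by (simp add: n_def power_add power2_eq_square mult_2 mult_ac)
      also have "\<dots> \<le> K * Y ^ (a + (2 * \<delta> + c))"
      proof (intro mult_mono)
        have "KD * KQ \<le> KD * (KQ + 1)" using KD(1) by simp
        then show "KD * KQ \<le> K" by (simp add: K_def)
        show "Y ^ (a + 2 * \<delta>) \<le> Y ^ (a + (2 * \<delta> + c))" using Y by (intro power_increasing) auto
      qed (use K0 Y in auto)
      finally have 1: "\<bar>of_int q\<bar> \<le> K * Y ^ (a + (2 * \<delta> + c))" .
      have "\<bar>of_int q * val 0 - of_int p\<bar> \<le> (KN * Y ^ \<delta>) * Y ^ n * (KE * x m ^ s)"
        unfolding diff using KN(2)[of m] KE(3)[of m] m Y KN(1) KE(1)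
        by (intro mult_mono) (auto simp: Y_def)
      also have "\<dots> = KN * KE * (Y ^ (\<delta> + n) / Y ^ s)" by (simp add: xY power_divide power_add)
      also have "\<dots> \<le> K * (1 / Y ^ a)"
      proof (intro mult_mono)
        show "KN * KE \<le> K" by (simp add: K_def)
        have "Y ^ (\<delta> + n) * Y ^ a = Y ^ (2 * n)" by (simp add: n_def mult_2 add_ac flip: power_add)
        also have "\<dots> \<le> Y ^ s" using s(1) Y by (intro power_increasing) auto
        finally show "Y ^ (\<delta> + n) / Y ^ s \<le> 1 / Y ^ a" using Y by (simp add: field_simps)
      qed (use K0 Y in auto)
      finally have 2: "\<bar>of_int q * val 0 - of_int p\<bar> \<le> K / Y ^ a" by simp
      have "1 / (K * Y ^ (a + (2 * \<delta> + c))) \<le> 1 / (KN * KE * Y ^ (a + (2 * \<delta> + c)))"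
        using KN(1) KE(1) Y by (intro frac_le mult_right_mono) (auto simp: K_def)
      also have "\<dots> \<le> (Y ^ \<delta> / KN) * Y ^ n * (x m ^ s / KE)"
      proof -
        have "Y ^ s \<le> Y ^ (\<delta> + n + (a + (2 * \<delta> + c)))"
          using s(2) Y by (intro power_increasing) (auto simp: n_def)
        then have "Y ^ s \<le> Y ^ (\<delta> + n) * Y ^ (a + (2 * \<delta> + c))"
          by (simp only: power_add[symmetric])
        then have "1 \<le> (Y ^ (\<delta> + n) / Y ^ s) * Y ^ (a + (2 * \<delta> + c))"
          using Y by (simp add: le_divide_eq)
        then have "1 / Y ^ (a + (2 * \<delta> + c)) \<le> Y ^ (\<delta> + n) / Y ^ s"
          using Y by (simp add: divide_le_eq)
        then have "1 / (KN * KE) * (1 / Y ^ (a + (2 * \<delta> + c))) \<le> 1 / (KN * KE) * (Y ^ (\<delta> + n) / Y ^ s)"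
          using KN(1) KE(1) by (intro mult_left_mono) auto
        then show ?thesis by (simp add: xY power_divide power_add mult_ac)
      qed
      also have "\<dots> \<le> \<bar>of_int q * val 0 - of_int p\<bar>"
        unfolding diff using KN(3)[of m] KE(2)[of m] m Y KN(1) KE(1) x_pos[of m]
        by (intro mult_mono) (auto simp: Y_def)
      finally have 3: "1 / (K * Y ^ (a + (2 * \<delta> + c))) \<le> \<bar>of_int q * val 0 - of_int p\<bar>" .
      have "real_of_int b ^ 2 ^ m = Y" by (simp add: Y_def X_def)
      then show "\<exists>p q::int. \<bar>of_int q\<bar> \<le> K * (of_int b ^ 2 ^ m) ^ (a + (2 * \<delta> + c)) \<and>
        \<bar>of_int q * val 0 - of_int p\<bar> \<le> K / (of_int b ^ 2 ^ m) ^ a \<and>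
        1 / (K * (of_int b ^ 2 ^ m) ^ (a + (2 * \<delta> + c))) \<le> \<bar>of_int q * val 0 - of_int p\<bar>"
        using 1 2 3 by auto
    qed
  qed
qed

section \<open>Transcendence of the value by Mahler's method\<close>

lemma transcendental: "\<not> algebraic (val 0)"
proof
  assume "algebraic (val 0)"
  then obtain d where liouville: "\<forall>N. \<exists>c>0. \<forall>(r :: nat \<Rightarrow> int) H. H \<ge> 1 \<longrightarrow> (\<forall>i\<le>N. \<bar>r i\<bar> \<le> H) \<longrightarrow>
      (\<Sum>i\<le>N. of_int (r i) * val 0 ^ i) \<noteq> 0 \<longrightarrow> c / of_int H ^ d \<le> \<bar>\<Sum>i\<le>N. of_int (r i) * val 0 ^ i\<bar>"
    by (rule algebraic_liouville)
  obtain F :: "int fps" and c where F: "F \<noteq> 0" "fps_conv_radius (of_int_fps F :: real fps) > 0"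
    and val: "\<exists>m0. \<forall>m\<ge>m0. val m = eval_fps (of_int_fps F) (x m)"
    and bad: "\<forall>P Q n. P \<noteq> 0 \<or> Q \<noteq> 0 \<longrightarrow> degree P \<le> n \<longrightarrow> degree Q \<le> n \<longrightarrow>
      (\<exists>i\<le>2 * n + c. fps_nth (fps_of_poly Q * F - fps_of_poly P) i \<noteq> 0)"
    and feq: "fps_of_poly D * F = fps_of_poly N * fps_sq F"
    by (rule series_data)
  have irr: "Q = 0" if "fps_of_poly Q * F = fps_of_poly P" for P Q
    using bad[rule_format, of P Q "max (degree P) (degree Q)"] that by auto
  obtain m1 where val: "\<And>m. m \<ge> m1 \<Longrightarrow> val m = eval_fps (of_int_fps F) (x m)" using val by blast
  obtain KD where "KD \<ge> 1" "\<forall>m. of_int (X m) ^ \<delta> / KD \<le> \<bar>real_of_int (cleared D m)\<bar> \<and>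
      \<bar>real_of_int (cleared D m)\<bar> \<le> KD * of_int (X m) ^ \<delta>"
    by (rule cleared_bounds[OF D_0 degree_D D_nonzero])
  then have KD: "KD \<ge> 1" "\<bar>real_of_int (cleared D m)\<bar> \<le> KD * of_int (X m) ^ \<delta>" for m
    by auto
  obtain KN where "KN \<ge> 1" "\<forall>m. of_int (X m) ^ \<delta> / KN \<le> \<bar>real_of_int (cleared N m)\<bar> \<and>
      \<bar>real_of_int (cleared N m)\<bar> \<le> KN * of_int (X m) ^ \<delta>"
    by (rule cleared_bounds[OF N_0 degree_N N_nonzero])
  then have KN: "KN \<ge> 1" "\<bar>real_of_int (cleared N m)\<bar> \<le> KN * of_int (X m) ^ \<delta>"
    "of_int (X m) ^ \<delta> / KN \<le> \<bar>real_of_int (cleared N m)\<bar>" for m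
    by auto
  define f where "f = (of_int_fps F :: real fps)"
  \<comment> \<open>The forms below have coefficients of size \<open>Y ^ w\<close> with
    \<open>w = n (\<delta> + 1)\<close>, so a contradiction needs \<open>n * n > w (d + 1)\<close>.
    This choice of \<open>n\<close> is possible because the Liouville exponent \<open>d\<close> does
    not depend on the degree of the form.\<close>
  define n where "n = (\<delta> + 1) * (d + 1) + 1"
  \<comment> \<open>One equation fewer than the \<open>(n + 1) ^ 2\<close> unknowns; only vanishing
    up to order \<open>n * n\<close> is used.\<close>
  define J where "J = {..<n * n + 2 * n}"
  define I where "I = {..n} \<times> {..n}"
  have "card J < card I" by (simp add: I_def J_def)
  then obtain y where y: "\<exists>ij\<in>I. y ij \<noteq> 0"
    "\<And>k. k \<in> J \<Longrightarrow> (\<Sum>ij\<in>I. fps_nth (fps_X ^ fst ij * F ^ snd ij) k * y ij) = 0"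
    using int_kernel_nontrivial[of J I "\<lambda>k ij. fps_nth (fps_X ^ fst ij * F ^ snd ij) k"]
    by (auto simp: I_def J_def)
  define A where "A = (\<lambda>j. \<Sum>i\<le>n. monom (y (i, j)) i)"
  have A_coeff: "coeff (A j) i = (if i \<le> n then y (i, j) else 0)" for i j
    by (simp add: A_def coeff_sum)
  have degA: "degree (A j) \<le> n" for j using A_coeff by (intro degree_le) auto
  obtain j0 where j0: "j0 \<le> n" "A j0 \<noteq> 0"
  proof -
    obtain i j where "i \<le> n" "j \<le> n" "y (i, j) \<noteq> 0" using y(1) by (auto simp: I_def)
    then have "coeff (A j) i \<noteq> 0" by (simp add: A_coeff)
    then have "A j \<noteq> 0" by auto
    then show ?thesis using that \<open>j \<le> n\<close> by blast
  qed
  define E where "E = (\<Sum>j\<le>n. fps_of_poly (A j) * F ^ j)"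
  have "E \<noteq> 0"
  proof
    assume "E = 0"
    have "A j0 = 0"
      using irr \<open>E = 0\<close>[unfolded E_def] j0(1) by (rule fps_transcendental[OF F(1) D_nz N_nz feq])
    then show False using j0(2) by simp
  qed
  have E_nth: "fps_nth E k = 0" if "k < n * n" for k
  proof -
    have "fps_of_poly (A j) = (\<Sum>i\<le>n. fps_const (y (i, j)) * fps_X ^ i)" for j
      by (simp add: A_def fps_of_poly_sum fps_of_poly_monom)
    then have "E = (\<Sum>j\<le>n. \<Sum>i\<le>n. fps_const (y (i, j)) * (fps_X ^ i * F ^ j))"
      by (simp add: E_def sum_distrib_right mult.assoc)
    also have "\<dots> = (\<Sum>i\<le>n. \<Sum>j\<le>n. fps_const (y (i, j)) * (fps_X ^ i * F ^ j))" by (rule sum.swap)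
    also have "\<dots> = (\<Sum>ij\<in>I. fps_const (y ij) * (fps_X ^ fst ij * F ^ snd ij))"
      unfolding I_def sum.cartesian_product by (intro sum.cong) auto
    finally have "fps_nth E k = (\<Sum>ij\<in>I. fps_nth (fps_X ^ fst ij * F ^ snd ij) k * y ij)"
      by (simp add: fps_sum_nth mult.commute)
    then show ?thesis using y(2)[of k] that by (simp add: J_def)
  qed
  define s where "s = subdegree E"
  have s: "n * n \<le> s" unfolding s_def using E_nth \<open>E \<noteq> 0\<close> by (intro subdegree_geI) auto
  define e where "e = (of_int_fps E :: real fps)"
  have e_eq: "e = (\<Sum>j\<le>n. fps_of_poly (of_int_poly (A j)) * f ^ j)"
    by (simp add: e_def E_def f_def of_int_fps_sum of_int_fps_mult of_int_fps_power)
  have e0: "e \<noteq> 0"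
    unfolding e_def using \<open>E \<noteq> 0\<close> of_int_fps_eq_iff[of E 0, where ?'a = real] by simp
  have s_e: "subdegree e = s"
    by (rule subdegreeI) (use \<open>E \<noteq> 0\<close> in \<open>auto simp: e_def s_def\<close>)
  have term_radius: "fps_conv_radius f \<le> fps_conv_radius (fps_of_poly p * f ^ j)" for p j
  proof -
    have "fps_conv_radius f \<le> min (fps_conv_radius (fps_of_poly p)) (fps_conv_radius (f ^ j))"
      using fps_conv_radius_power[of f j] by simp
    also have "\<dots> \<le> fps_conv_radius (fps_of_poly p * f ^ j)" by (rule fps_conv_radius_mult)
    finally show ?thesis .
  qed
  have sum_radius: "fps_conv_radius f \<le> fps_conv_radius (\<Sum>j\<in>S. fps_of_poly (p j) * f ^ j)" if "finite S" for S p
    using that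
  proof induction
    case (insert j S)
    then have "fps_conv_radius f \<le> min (fps_conv_radius (fps_of_poly (p j) * f ^ j))
        (fps_conv_radius (\<Sum>j\<in>S. fps_of_poly (p j) * f ^ j))"
      using term_radius by simp
    also have "\<dots> \<le> fps_conv_radius (fps_of_poly (p j) * f ^ j + (\<Sum>j\<in>S. fps_of_poly (p j) * f ^ j))"
      by (rule fps_conv_radius_add)
    finally show ?case using insert by simp
  qed simp
  have eval_sum: "eval_fps (\<Sum>j\<in>S. fps_of_poly (p j) * f ^ j) z = (\<Sum>j\<in>S. poly (p j) z * eval_fps f z ^ j)"
    if "finite S" "ereal (norm z) < fps_conv_radius f" for S p z
    using that(1)
  proof induction
    case (insert j S)
    have 1: "ereal (norm z) < fps_conv_radius (fps_of_poly (p j) * f ^ j)"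
      using that(2) term_radius by (rule less_le_trans)
    have 2: "ereal (norm z) < fps_conv_radius (\<Sum>j\<in>S. fps_of_poly (p j) * f ^ j)"
      using that(2) sum_radius[OF insert(1)] by (rule less_le_trans)
    have 3: "ereal (norm z) < fps_conv_radius (f ^ j)"
      using that(2) fps_conv_radius_power by (rule less_le_trans)
    have "eval_fps (fps_of_poly (p j) * f ^ j) z = poly (p j) z * eval_fps f z ^ j"
      using 3 that(2) by (simp add: eval_fps_mult eval_fps_power)
    then show ?case using insert eval_fps_add[OF 1 2] by simp
  qed simp
  have rad_e: "fps_conv_radius e > 0"
    using F(2) sum_radius[of "{..n}"] unfolding e_eq f_def by (simp add: less_le_trans)
  obtain KE mE where "KE \<ge> 1" "\<forall>m\<ge>mE. x m ^ subdegree e / KE \<le> \<bar>eval_fps e (x m)\<bar> \<and>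
      \<bar>eval_fps e (x m)\<bar> \<le> KE * x m ^ subdegree e"
    by (rule eval_fps_leading_term[OF e0 rad_e x_LIMSEQ x_pos])
  then have KE: "KE \<ge> 1" "m \<ge> mE \<Longrightarrow> x m ^ s / KE \<le> \<bar>eval_fps e (x m)\<bar>"
    "m \<ge> mE \<Longrightarrow> \<bar>eval_fps e (x m)\<bar> \<le> KE * x m ^ s" for m
    unfolding s_e by auto
  obtain m2 where m2: "\<And>m. m \<ge> m2 \<Longrightarrow> ereal (x m) < fps_conv_radius f"
    using eventually_x_less_radius[OF F(2)] unfolding eventually_sequentially f_def by blast
  define KA where "KA = (\<Sum>j\<le>n. \<Sum>i\<le>degree (A j). \<bar>real_of_int (coeff (A j) i)\<bar>)"
  have KA: "\<bar>peval (A j) m\<bar> \<le> KA" if "j \<le> n" for j m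
  proof -
    have "\<bar>peval (A j) m\<bar> \<le> (\<Sum>i\<le>degree (A j). \<bar>real_of_int (coeff (A j) i)\<bar>)"
      using x_pos[of m] x_le_1[of m] by (intro poly_of_int_poly_bound) auto
    also have "\<dots> \<le> KA" unfolding KA_def
      using that by (intro member_le_sum[of _ _ "\<lambda>j. \<Sum>i\<le>degree (A j). \<bar>real_of_int (coeff (A j) i)\<bar>"]) (auto intro: sum_nonneg)
    finally show ?thesis .
  qed
  have KA0: "KA \<ge> 0" by (simp add: KA_def sum_nonneg)
  define K0 where "K0 = max KD KN"
  have K0: "K0 \<ge> 1" "KD \<le> K0" "KN \<le> K0" using KD(1) by (auto simp: K0_def)
  define L where "L = KA * K0 ^ n + 1"
  define w where "w = n + \<delta> * n"
  obtain c0 where c0: "c0 > 0" and lower: "\<And>(r :: nat \<Rightarrow> int) H. H \<ge> 1 \<Longrightarrow> (\<And>i. i \<le> n \<Longrightarrow> \<bar>r i\<bar> \<le> H) \<Longrightarrow>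
      (\<Sum>i\<le>n. of_int (r i) * val 0 ^ i) \<noteq> 0 \<Longrightarrow> c0 / of_int H ^ d \<le> \<bar>\<Sum>i\<le>n. of_int (r i) * val 0 ^ i\<bar>"
    using liouville[rule_format, of n] by auto
  have L1: "L \<ge> 1" using KA0 K0 by (simp add: L_def)
  have bounded: "of_int (X m) \<le> (2 * L) ^ d * (K0 ^ n * KE) / c0" if m: "m \<ge> max m1 (max mE m2)" for m
  proof -
    define Y where "Y = real_of_int (X m)"
    have Y: "Y \<ge> 1" "Y > 0" using X_ge_2[of m] by (auto simp: Y_def)
    have xY: "x m = 1 / Y" by (simp add: x_def Y_def)
    \<comment> \<open>Multiplying \<open>E\<close> at \<open>x m\<close> by
      \<open>(cleared N m) ^ n\<close> and replacing \<open>cleared N m * val m\<close> by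
      \<open>cleared D m * val 0\<close> makes it a form in \<open>val 0\<close>; the factor
      \<open>Y ^ n\<close> makes its coefficients integers.\<close>
    define r where "r = (\<lambda>j. homogeneous_value (A j) n (X m) * cleared D m ^ j * cleared N m ^ (n - j))"
    define H where "H = \<lceil>L * Y ^ w\<rceil>"
    have LY: "L * Y ^ w \<ge> 1" using L1 Y one_le_power[of Y w] mult_mono[of 1 L 1 "Y ^ w"] by simp
    have H: "H \<ge> 1" "of_int H \<le> 2 * (L * Y ^ w)" using LY unfolding H_def by linarith+
    have Y_w: "Y ^ n * (K0 * Y ^ \<delta>) ^ n = K0 ^ n * Y ^ w"
      by (simp add: w_def power_add power_mult power_mult_distrib)
    have "KD * Y ^ \<delta> \<le> K0 * Y ^ \<delta>" "KN * Y ^ \<delta> \<le> K0 * Y ^ \<delta>"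
      using K0 Y by (auto intro!: mult_right_mono)
    then have D_le: "\<bar>real_of_int (cleared D m)\<bar> \<le> K0 * Y ^ \<delta>"
      and N_le: "\<bar>real_of_int (cleared N m)\<bar> \<le> K0 * Y ^ \<delta>"
      using KD(2)[of m] KN(2)[of m] unfolding Y_def by linarith+
    have r_le: "\<bar>r j\<bar> \<le> H" if "j \<le> n" for j
    proof -
      have "\<bar>real_of_int (r j)\<bar> = Y ^ n * \<bar>peval (A j) m\<bar> * \<bar>real_of_int (cleared D m)\<bar> ^ j * \<bar>real_of_int (cleared N m)\<bar> ^ (n - j)"
        using Y degA[of j] by (simp add: r_def of_int_homogeneous_value_X abs_mult power_abs Y_def)
      also have "\<dots> \<le> Y ^ n * KA * (K0 * Y ^ \<delta>) ^ j * (K0 * Y ^ \<delta>) ^ (n - j)"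
        using Y KA[OF that] KA0 D_le N_le K0(1) by (intro mult_mono power_mono) auto
      also have "\<dots> = KA * (Y ^ n * (K0 * Y ^ \<delta>) ^ n)"
        using that by (simp add: mult_ac flip: power_add)
      also have "\<dots> = KA * K0 ^ n * Y ^ w" by (simp add: Y_w)
      also have "\<dots> \<le> L * Y ^ w" using Y by (simp add: L_def mult_right_mono)
      finally show ?thesis unfolding H_def by (simp add: le_ceiling_iff)
    qed
    have *: "ereal (norm (x m)) < fps_conv_radius f" using m2[of m] m x_pos[of m] by simp
    have eval_e: "eval_fps e (x m) = (\<Sum>j\<le>n. peval (A j) m * val m ^ j)"
      unfolding e_eq using eval_sum[OF _ *, of "{..n}"] val[of m] m by (simp add: f_def)
    have "(\<Sum>j\<le>n. of_int (r j) * val 0 ^ j) =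
        (\<Sum>j\<le>n. Y ^ n * peval (A j) m * of_int (cleared N m) ^ (n - j) * (val 0 * of_int (cleared D m)) ^ j)"
      using degA by (intro sum.cong) (simp_all add: r_def of_int_homogeneous_value_X Y_def power_mult_distrib mult_ac)
    also have "\<dots> = (\<Sum>j\<le>n. Y ^ n * of_int (cleared N m) ^ n * (peval (A j) m * val m ^ j))"
    proof (intro sum.cong refl)
      fix j assume "j \<in> {..n}"
      then have "real_of_int (cleared N m) ^ n = of_int (cleared N m) ^ (n - j) * of_int (cleared N m) ^ j"
        by (simp flip: power_add)
      then show "Y ^ n * peval (A j) m * of_int (cleared N m) ^ (n - j) * (val 0 * of_int (cleared D m)) ^ j
          = Y ^ n * of_int (cleared N m) ^ n * (peval (A j) m * val m ^ j)"
        unfolding val_cleared by (simp only: power_mult_distrib mult_ac)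
    qed
    also have "\<dots> = Y ^ n * of_int (cleared N m) ^ n * eval_fps e (x m)"
      unfolding eval_e by (simp only: sum_distrib_left)
    finally have form: "(\<Sum>j\<le>n. of_int (r j) * val 0 ^ j) = Y ^ n * of_int (cleared N m) ^ n * eval_fps e (x m)" .
    have eval_pos: "\<bar>eval_fps e (x m)\<bar> > 0"
    proof -
      have "x m ^ s / KE > 0" using x_pos[of m] KE(1) by simp
      then show ?thesis using KE(2)[of m] m by linarith
    qed
    have cleared_pos: "\<bar>real_of_int (cleared N m)\<bar> > 0"
    proof -
      have "Y ^ \<delta> / KN > 0" using Y KN(1) by simp
      then show ?thesis using KN(3)[of m] unfolding Y_def by linarith
    qed
    have "(\<Sum>j\<le>n. of_int (r j) * val 0 ^ j) \<noteq> 0"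
      unfolding form using Y eval_pos cleared_pos by auto
    from lower[OF H(1) r_le this]
    have "c0 / of_int H ^ d \<le> \<bar>\<Sum>j\<le>n. of_int (r j) * val 0 ^ j\<bar>" .
    also have "\<dots> = Y ^ n * \<bar>real_of_int (cleared N m)\<bar> ^ n * \<bar>eval_fps e (x m)\<bar>"
      unfolding form using Y by (simp add: abs_mult power_abs)
    also have "\<dots> \<le> Y ^ n * (K0 * Y ^ \<delta>) ^ n * (KE * x m ^ s)"
      using N_le KE(3)[of m] m Y K0(1) by (intro mult_mono power_mono) auto
    also have "\<dots> = K0 ^ n * KE * Y ^ w / Y ^ s"
      by (simp add: xY Y_w power_divide)
    finally have upper: "c0 / of_int H ^ d \<le> K0 ^ n * KE * Y ^ w / Y ^ s" .
    have H0: "real_of_int H > 0" using H(1) by simp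
    have "c0 * Y ^ s \<le> K0 ^ n * KE * Y ^ w * of_int H ^ d"
      using upper H0 Y by (simp add: field_simps)
    also have "\<dots> \<le> K0 ^ n * KE * Y ^ w * (2 * (L * Y ^ w)) ^ d"
      using H H0 Y K0(1) KE(1) by (intro mult_left_mono power_mono) auto
    also have "\<dots> = (2 * L) ^ d * (K0 ^ n * KE) * Y ^ (w * (d + 1))"
    proof -
      have "(2 * (L * Y ^ w)) ^ d = (2 * L) ^ d * Y ^ (w * d)"
        by (simp add: power_mult_distrib power_mult)
      moreover have "Y ^ (w * (d + 1)) = Y ^ w * Y ^ (w * d)" by (simp flip: power_add)
      ultimately show ?thesis by (simp only: mult_ac)
    qed
    finally have main: "c0 * Y ^ s \<le> (2 * L) ^ d * (K0 ^ n * KE) * Y ^ (w * (d + 1))" .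
    \<comment> \<open>The order of vanishing beats the Liouville exponent by at least 1, so one
      factor \<open>Y\<close> survives and is bounded, although \<open>X m\<close> tends to
      infinity.\<close>
    have "w * (d + 1) + n = n * n" by (simp add: w_def n_def algebra_simps)
    moreover have "n \<ge> 1" by (simp add: n_def)
    ultimately have "w * (d + 1) + 1 \<le> s" using s by linarith
    then have "Y ^ (w * (d + 1) + 1) \<le> Y ^ s" using Y by (intro power_increasing) auto
    then have "c0 * (Y ^ (w * (d + 1)) * Y) \<le> c0 * Y ^ s"
      using c0 by (intro mult_left_mono) (simp_all add: mult.commute)
    with main have "Y ^ (w * (d + 1)) * (c0 * Y) \<le> Y ^ (w * (d + 1)) * ((2 * L) ^ d * (K0 ^ n * KE))"
      by (simp add: mult_ac)
    then have "c0 * Y \<le> (2 * L) ^ d * (K0 ^ n * KE)" using Y by simp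
    then show ?thesis using c0 by (simp add: Y_def field_simps)
  qed
  define B where "B = (2 * L) ^ d * (K0 ^ n * KE) / c0"
  obtain M :: nat where M: "B < real M" using reals_Archimedean2 by blast
  define m where "m = max M (max m1 (max mE m2))"
  have "M \<le> m" by (simp add: m_def)
  moreover have "int m < 2 ^ m" by (rule of_nat_less_two_power)
  moreover have "(2::int) ^ m \<le> X m"
    using X_ge[of m] power_increasing[of m "m + 1" "2 :: int"] by linarith
  ultimately have "int M \<le> X m" by linarith
  then have "real M \<le> of_int (X m)" by linarith
  moreover have "of_int (X m) \<le> B" unfolding B_def by (rule bounded) (simp add: m_def)
  ultimately show False using M by linarith
qed

section \<open>Irrationality exponent of the value and conclusion\<close>

lemma irrationality_exponent_val: "irrationality_exponent (val 0) = 2"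
proof (rule irrationality_exponent_eq_2I)
  show "val 0 \<notin> \<rat>"
  proof
    assume "val 0 \<in> \<rat>"
    then obtain p q :: int where pq: "q > 0" "val 0 = of_int p / of_int q" by (elim Rats_cases') blast
    have "algebraic (val 0)"
      by (rule algebraicI[of "[:- of_int p, of_int q:]"])
        (use pq in \<open>auto simp: coeff_pCons split: nat.splits\<close>)
    then show False using transcendental by simp
  qed
  fix e :: real assume e: "e > 0"
  obtain \<gamma> where \<gamma>: "\<And>a. \<exists>K>0. \<exists>m0. \<forall>m\<ge>m0. \<exists>p q::int.
        \<bar>of_int q\<bar> \<le> K * (of_int b ^ 2 ^ m) ^ (a + \<gamma>) \<and>
        \<bar>of_int q * val 0 - of_int p\<bar> \<le> K / (of_int b ^ 2 ^ m) ^ a \<and>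
        1 / (K * (of_int b ^ 2 ^ m) ^ (a + \<gamma>)) \<le> \<bar>of_int q * val 0 - of_int p\<bar>"
    using rational_approximations by blast
  \<comment> \<open>\<open>k\<close> plays the role of \<open>N\<close> in the lower bound, whose
    exponent exceeds 2 by \<open>2 (\<gamma> + 1) / k\<close>; this is brought below
    \<open>e\<close>.\<close>
  obtain k :: nat where k: "2 * (real \<gamma> + 1) / e < real k" using reals_Archimedean2 by blast
  have "2 * (real \<gamma> + 1) / e > 0" using e by simp
  then have k0: "k > 0" using k by linarith
  have b2: "real_of_int b \<ge> 2" using b_ge_2 by simp
  obtain c q0 :: real where c: "c > 0" "\<And>p q::int. of_int q \<ge> q0 \<Longrightarrow> q > 0 \<Longrightarrow>
      c * of_int q powr (- (2 + 2 * ((real \<gamma> + 1) / real k))) \<le> \<bar>val 0 - of_int p / of_int q\<bar>"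
    using rational_approximation_lower_bound[OF b2 k0 \<gamma>] by blast
  have exponent: "2 * ((real \<gamma> + 1) / real k) \<le> e" using k k0 e by (simp add: field_simps)
  show "\<exists>c q0 :: real. c > 0 \<and> (\<forall>p q::int. of_int q \<ge> q0 \<longrightarrow> q > 0 \<longrightarrow>
      c * of_int q powr (- (2 + e)) \<le> \<bar>val 0 - of_int p / of_int q\<bar>)"
  proof (rule exI[of _ c], rule exI[of _ q0], intro conjI c(1) allI impI)
    fix p q :: int assume q: "of_int q \<ge> q0" "q > 0"
    have "of_int q powr (- (2 + e)) \<le> of_int q powr (- (2 + 2 * ((real \<gamma> + 1) / real k)))"
      using q(2) exponent by (intro powr_mono) auto
    then have "c * of_int q powr (- (2 + e)) \<le> c * of_int q powr (- (2 + 2 * ((real \<gamma> + 1) / real k)))"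
      using c(1) by simp
    then show "c * of_int q powr (- (2 + e)) \<le> \<bar>val 0 - of_int p / of_int q\<bar>"
      using c(2)[OF q, of p] by linarith
  qed
qed

end

theorem theorem2p2:
  fixes u :: int and C D :: "int poly" and b :: int
  assumes "poly D 0 = 1"
    and "b \<ge> 2"
    and "\<forall>m::nat. poly (map_poly of_int D) (1 / real_of_int b ^ (2 ^ m))
                   * mprod_val u C D (1 / real_of_int b ^ (2 ^ m)) \<noteq> 0"
    and "\<not> rational_mod4 (mprod_fps u C D)"
  shows "\<not> algebraic (mprod_val u C D (1 / real_of_int b))
    \<and> irrationality_exponent (mprod_val u C D (1 / real_of_int b)) = 2"
proof -
  interpret mahler_product u C D b
    using assms by unfold_locales (auto simp: poly_0_coeff_0)
  have "val 0 = mprod_val u C D (1 / real_of_int b)" by (simp add: val_def x_def X_def)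
  then show ?thesis using transcendental irrationality_exponent_val by simp
qed

end
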